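(* Let $A_1,A_2\in\mathbf{C}^{n\times n}$, $B_1,B_2\in\mathbf{C}^{n\times m}$, and assume the system $x^+=A_1x+A_2^{\#}x^{\#}+B_1u+B_2^{\#}u^{\#}$, $x(0)=x_0$ (continuous time $t\in\mathbf{R}^+$, $x^+=\dot x$, or discrete time $t\in\mathbf{Z}^+$, $x^+(t)=x(t+1)$) is stabilizable. Let $\{Q_1,Q_2\}>0$ ($Q_i\in\mathbf{C}^{n\times n}$) and $\{R_1,R_2\}>0$ ($R_i\in\mathbf{C}^{m\times m}$) and consider the cost $$J(u)=\int_0^\infty\mathrm{Re}\big(x^{\mathrm H}\{Q_1,Q_2\}x+u^{\mathrm H}\{R_1,R_2\}u\big)\,\mathrm{d}t\ (t\in\mathbf{R}^+),\qquad J(u)=\sum_{t=0}^\infty\mathrm{Re}\big(x^{\mathrm H}\{Q_1,Q_2\}x+u^{\mathrm H}\{R_1,R_2\}u\big)\ (t\in\mathbf{Z}^+).$$ Then there is a unique bimatrix $\{P_1,P_2\}>0$ ($P_i\in\mathbf{C}^{n\times n}$) solving, for $t\in\mathbf{R}^+$, $$-\{Q_1,Q_2\}=\{A_1,A_2\}^{\mathrm H}\{P_1,P_2\}+\{P_1,P_2\}\{A_1,A_2\}-\{P_1,P_2\}\{B_1,B_2\}\{R_1,R_2\}^{-1}\{B_1,B_2\}^{\mathrm H}\{P_1,P_2\},$$ and, for $t\in\mathbf{Z}^+$, $$-\{Q_1,Q_2\}=\{A_1,A_2\}^{\mathrm H}\{P_1,P_2\}\{A_1,A_2\}-\{P_1,P_2\}-\{A_1,A_2\}^{\mathrm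 H}\{P_1,P_2\}\{B_1,B_2\}\{S_1,S_2\}^{-1}\{B_1,B_2\}^{\mathrm H}\{P_1,P_2\}\{A_1,A_2\},$$ where $\{S_1,S_2\}=\{R_1,R_2\}+\{B_1,B_2\}^{\mathrm H}\{P_1,P_2\}\{B_1,B_2\}$. Moreover, the control minimizing $J$ is the full state feedback $u^*=\{K_1^*,K_2^*\}x$ with $$\{K_1^*,K_2^*\}=-\{R_1,R_2\}^{-1}\{B_1,B_2\}^{\mathrm H}\{P_1,P_2\}\ (t\in\mathbf{R}^+),\qquad \{K_1^*,K_2^*\}=-\{S_1,S_2\}^{-1}\{B_1,B_2\}^{\mathrm H}\{P_1,P_2\}\{A_1,A_2\}\ (t\in\mathbf{Z}^+),$$ the resulting closed-loop system is asymptotically stable, and the minimal cost is $J_{\min}(u^* )=\mathrm{Re}\big(x_0^{\mathrm H}\{P_1,P_2\}x_0\big)$.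
   Context: $P^{\#}$, $P^{\mathrm T}$, $P^{\mathrm H}$: entrywise conjugate, transpose, conjugate transpose. For $A_1,A_2\in\mathbf{C}^{n\times m}$, the bimatrix $\{A_1,A_2\}$ is the real-linear map $x\mapsto A_1x+A_2^{\#}x^{\#}$; equality means equality as maps; sums pointwise, products compositions ($\{A_1,A_2\}\{B_1,B_2\}=\{A_1B_1+A_2^{\#}B_2,A_1^{\#}B_2+A_2B_1\}$), $-\{A_1,A_2\}=\{-A_1,-A_2\}$, identity $\{I,0\}$, inverse = two-sided inverse bimatrix, conjugate transpose $\{A_1,A_2\}^{\mathrm H}=\{A_1^{\mathrm H},A_2^{\mathrm T}\}$. A square bimatrix $\{P_1,P_2\}$ is positive definite ($>0$) if $P_1=P_1^{\mathrm H}$, $P_2=P_2^{\mathrm T}$ and $\mathrm{Re}(x^{\mathrm H}(P_1x+P_2^{\#}x^{\#}))>0$ for all $x\ne0$. The system is stabilizable if some full state feedback $u=K_1x+K_2^{\#}x^{\#}$ makes the closed loop asymptotically stable (equivalently, the real pair $(\{A_1,A_2\}_\circ,\{B_1,B_2\}_\circ)$ is stabilizable, where $\{A_1,A_2\}_\circ=\begin{bmatrix}\mathrm{Re}(A_1+A_2) & -\mathrm{Im}(A_1+A_2)\\ \mathrm{Im}(A_1-A_2) & \mathrm{Re}(A_1-A_2)\end{bmatrix}$). *)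

theory Defs
  imports "HOL-Analysis.Analysis"
begin

definition cvec :: "complex^'n \<Rightarrow> complex^'n" where
  "cvec x = (\<chi> i. cnj (x $ i))"

definition cmat :: "complex^'m^'n \<Rightarrow> complex^'m^'n" where
  "cmat A = (\<chi> i j. cnj (A $ i $ j))"

type_synonym ('n,'m) bimat = "(complex^'m^'n) \<times> (complex^'m^'n)"

definition bm_app :: "('n::finite,'m::finite) bimat \<Rightarrow> complex^'m \<Rightarrow> complex^'n" where
  "bm_app X x = fst X *v x + cmat (snd X) *v cvec x"

definition bm_eq :: "('n::finite,'m::finite) bimat \<Rightarrow> ('n,'m) bimat \<Rightarrow> bool" where
  "bm_eq X Y \<longleftrightarrow> bm_app X = bm_app Y"

definition bm_add :: "('n::finite,'m::finite) bimat \<Rightarrow> ('n,'m) bimat \<Rightarrow> ('n,'m) bimat" where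
  "bm_add X Y = (fst X + fst Y, snd X + snd Y)"

definition bm_neg :: "('n::finite,'m::finite) bimat \<Rightarrow> ('n,'m) bimat" where
  "bm_neg X = (- fst X, - snd X)"

definition bm_sub :: "('n::finite,'m::finite) bimat \<Rightarrow> ('n,'m) bimat \<Rightarrow> ('n,'m) bimat" where
  "bm_sub X Y = bm_add X (bm_neg Y)"

text \<open>Product = composition: {A1,A2}{B1,B2} = {A1 B1 + A2^# B2, A1^# B2 + A2 B1}.\<close>
definition bm_mult :: "('n::finite,'k::finite) bimat \<Rightarrow> ('k,'m::finite) bimat \<Rightarrow> ('n,'m) bimat" where
  "bm_mult X Y = (fst X ** fst Y + cmat (snd X) ** snd Y, cmat (fst X) ** snd Y + snd X ** fst Y)"

definition bm_H :: "('n::finite,'m::finite) bimat \<Rightarrow> ('m,'n) bimat" where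
  "bm_H X = (transpose (cmat (fst X)), transpose (snd X))"

definition bm_id :: "('n::finite,'n) bimat" where
  "bm_id = (mat 1, 0)"

definition bm_is_inverse :: "('n::finite,'n) bimat \<Rightarrow> ('n,'n) bimat \<Rightarrow> bool" where
  "bm_is_inverse X Y \<longleftrightarrow> bm_eq (bm_mult X Y) bm_id \<and> bm_eq (bm_mult Y X) bm_id"

definition bm_inv :: "('n::finite,'n) bimat \<Rightarrow> ('n,'n) bimat" where
  "bm_inv X = (SOME Y. bm_is_inverse X Y)"

definition cinner :: "complex^'n::finite \<Rightarrow> complex^'n \<Rightarrow> complex" where
  "cinner x y = (\<Sum>i\<in>UNIV. cnj (x $ i) * y $ i)"

definition bm_pos_def :: "('n::finite,'n) bimat \<Rightarrow> bool" where
  "bm_pos_def P \<longleftrightarrow> transpose (cmat (fst P)) = fst P \<and> transpose (snd P) = snd P \<and>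
     (\<forall>x. x \<noteq> 0 \<longrightarrow> Re (cinner x (bm_app P x)) > 0)"

definition stage_cost :: "('n::finite,'n) bimat \<Rightarrow> ('m::finite,'m) bimat \<Rightarrow> complex^'n \<Rightarrow> complex^'m \<Rightarrow> real" where
  "stage_cost Q R x u = Re (cinner x (bm_app Q x) + cinner u (bm_app R u))"

text \<open>(x,u) is a trajectory of x' = A x + B u, x(0) = x0 on t >= 0: u is locally (absolutely)
  integrable and x is the (Caratheodory) solution, x(t) = x0 + int_0^t (A x + B u).\<close>
definition ct_traj :: "('n::finite,'n) bimat \<Rightarrow> ('n,'m::finite) bimat \<Rightarrow> complex^'n \<Rightarrow>
    (real \<Rightarrow> complex^'n) \<Rightarrow> (real \<Rightarrow> complex^'m) \<Rightarrow> bool" where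
  "ct_traj A B x0 x u \<longleftrightarrow>
     (\<forall>t\<ge>0. u absolutely_integrable_on {0..t}) \<and>
     (\<forall>t\<ge>0. ((\<lambda>s. bm_app A (x s) + bm_app B (u s)) has_integral (x t - x0)) {0..t})"

definition ct_cost :: "('n::finite,'n) bimat \<Rightarrow> ('m::finite,'m) bimat \<Rightarrow>
    (real \<Rightarrow> complex^'n) \<Rightarrow> (real \<Rightarrow> complex^'m) \<Rightarrow> ennreal" where
  "ct_cost Q R x u = (\<integral>\<^sup>+ t \<in> {0..}. ennreal (stage_cost Q R (x t) (u t)) \<partial>lborel)"

definition ct_asymp_stable :: "('n::finite,'n) bimat \<Rightarrow> bool" where
  "ct_asymp_stable F \<longleftrightarrow>
     (\<forall>x0 (x :: real \<Rightarrow> complex^'n). (\<forall>t\<ge>0. ((\<lambda>s. bm_app F (x s)) has_integral (x t - x0)) {0..t})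
        \<longrightarrow> (x \<longlongrightarrow> 0) at_top)"

definition ct_stabilizable :: "('n::finite,'n) bimat \<Rightarrow> ('n,'m::finite) bimat \<Rightarrow> bool" where
  "ct_stabilizable A B \<longleftrightarrow> (\<exists>K :: ('m,'n) bimat. ct_asymp_stable (bm_add A (bm_mult B K)))"

definition dt_traj :: "('n::finite,'n) bimat \<Rightarrow> ('n,'m::finite) bimat \<Rightarrow> complex^'n \<Rightarrow>
    (nat \<Rightarrow> complex^'n) \<Rightarrow> (nat \<Rightarrow> complex^'m) \<Rightarrow> bool" where
  "dt_traj A B x0 x u \<longleftrightarrow> x 0 = x0 \<and> (\<forall>t. x (Suc t) = bm_app A (x t) + bm_app B (u t))"

definition dt_cost :: "('n::finite,'n) bimat \<Rightarrow> ('m::finite,'m) bimat \<Rightarrow>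
    (nat \<Rightarrow> complex^'n) \<Rightarrow> (nat \<Rightarrow> complex^'m) \<Rightarrow> ennreal" where
  "dt_cost Q R x u = (\<Sum>t. ennreal (stage_cost Q R (x t) (u t)))"

definition dt_asymp_stable :: "('n::finite,'n) bimat \<Rightarrow> bool" where
  "dt_asymp_stable F \<longleftrightarrow> (\<forall>x. (\<forall>t. x (Suc t) = bm_app F (x t)) \<longrightarrow> x \<longlonglongrightarrow> 0)"

definition dt_stabilizable :: "('n::finite,'n) bimat \<Rightarrow> ('n,'m::finite) bimat \<Rightarrow> bool" where
  "dt_stabilizable A B \<longleftrightarrow> (\<exists>K :: ('m,'n) bimat. dt_asymp_stable (bm_add A (bm_mult B K)))"

definition care :: "('n::finite,'n) bimat \<Rightarrow> ('n,'m::finite) bimat \<Rightarrow> ('n,'n) bimat \<Rightarrow> ('m,'m) bimat \<Rightarrow>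
    ('n,'n) bimat \<Rightarrow> bool" where
  "care A B Q R P \<longleftrightarrow> bm_eq (bm_neg Q)
     (bm_sub (bm_add (bm_mult (bm_H A) P) (bm_mult P A))
             (bm_mult (bm_mult (bm_mult (bm_mult P B) (bm_inv R)) (bm_H B)) P))"

definition dS :: "('n::finite,'m::finite) bimat \<Rightarrow> ('m,'m) bimat \<Rightarrow> ('n,'n) bimat \<Rightarrow> ('m,'m) bimat" where
  "dS B R P = bm_add R (bm_mult (bm_mult (bm_H B) P) B)"

definition dare :: "('n::finite,'n) bimat \<Rightarrow> ('n,'m::finite) bimat \<Rightarrow> ('n,'n) bimat \<Rightarrow> ('m,'m) bimat \<Rightarrow>
    ('n,'n) bimat \<Rightarrow> bool" where
  "dare A B Q R P \<longleftrightarrow> bm_eq (bm_neg Q)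
     (bm_sub (bm_sub (bm_mult (bm_mult (bm_H A) P) A) P)
       (bm_mult (bm_mult (bm_mult (bm_mult (bm_mult (bm_mult (bm_H A) P) B) (bm_inv (dS B R P))) (bm_H B)) P) A))"

definition ct_gain :: "('n::finite,'m::finite) bimat \<Rightarrow> ('m,'m) bimat \<Rightarrow> ('n,'n) bimat \<Rightarrow> ('m,'n) bimat" where
  "ct_gain B R P = bm_neg (bm_mult (bm_mult (bm_inv R) (bm_H B)) P)"

definition dt_gain :: "('n::finite,'n) bimat \<Rightarrow> ('n,'m::finite) bimat \<Rightarrow> ('m,'m) bimat \<Rightarrow> ('n,'n) bimat \<Rightarrow> ('m,'n) bimat" where
  "dt_gain A B R P = bm_neg (bm_mult (bm_mult (bm_mult (bm_inv (dS B R P)) (bm_H B)) P) A)"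

end

theory Submission
  imports Defs
begin

text \<open>
  Bimatrices are exactly the real-linear maps between the Euclidean spaces \<open>\<complex>\<^sup>n\<close>, with the conjugate
  transpose as adjoint and \<open>Re (x\<^sup>H y)\<close> as inner product, so the statement is the real
  linear-quadratic regulator theorem.  For a stabilizing feedback, the Lyapunov equation has trivial
  kernel (bilinear invariants of the flow vanish in the limit) and is therefore solvable.  Starting
  from its solution, value iteration (discrete time) and Kleinman's policy iteration (continuous
  time) yield decreasing sequences of positive semidefinite operators whose limits solve the Riccati
  equations.  Completing the square shows that the cost of any control exceeds
  \<open>x\<^sub>0 \<bullet> P x\<^sub>0\<close> by the accumulated \<open>R\<close>- or \<open>S\<close>-weighted square of \<open>u - K x\<close>: finite cost forces the terminal term
  \<open>x(T) \<bullet> P x(T)\<close> to become arbitrarily small.  Uniqueness of \<open>P\<close> follows as \<open>x\<^sub>0 \<bullet> P x\<^sub>0\<close> is the minimal cost.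
\<close>

section \<open>Bimatrices as real-linear maps\<close>

text \<open>Gains and Riccati equations are kept in weak form: a gain through its first-order
  condition tested against every \<open>u\<close>, a Riccati equation as an identity of quadratic
  forms. The inverses and matrix equations of the theorem enter only at the end, where
  self-adjointness of the residual makes the quadratic identity equivalent to the operator identity.
  The two time domains need different iterations: the discrete Bellman operator is a pointwise
  minimum over inputs, hence monotone, so one supersolution starts a decreasing orbit; its
  continuous analogue would be a nonlinear differential equation for \<open>P\<close>, whereas
  policy iteration only asks for linear Lyapunov equations. The obstacle in continuous time is
  regularity: \<open>u\<close> is only locally integrable, so \<open>x\<close> need not be
  differentiable, and neither \<open>u \<bullet> R u\<close> nor the weighted square of
  \<open>u - K x\<close> need be integrable on bounded intervals. Only their difference, affine in
  \<open>u\<close>, is always integrable there. For the same reason the terminal term is made small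
  merely at some arbitrarily late times, which is enough for the lower bound and for uniqueness of
  the control.\<close>

lemma Re_cinner: "Re (cinner x y) = x \<bullet> y"
  by (simp add: cinner_def inner_vec_def inner_complex_def)

lemma cmat_nth [simp]: "cmat A $ i $ j = cnj (A $ i $ j)"
  by (simp add: cmat_def)

lemma cmat_cmat [simp]: "cmat (cmat A) = A"
  by (simp add: cmat_def vec_eq_iff)

lemma bm_app_nth: "bm_app X x $ i = (\<Sum>j\<in>UNIV. fst X $ i $ j * x $ j + cnj (snd X $ i $ j) * cnj (x $ j))"
  by (simp add: bm_app_def matrix_vector_mult_def cvec_def sum.distrib)

lemma linear_bm_app: "linear (bm_app X)"
  by (rule linearI)
    (simp_all add: vec_eq_iff bm_app_nth algebra_simps sum.distrib scaleR_sum_right)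

lemma bm_app_add [simp]: "bm_app (bm_add X Y) x = bm_app X x + bm_app Y x"
  by (simp add: bm_add_def vec_eq_iff bm_app_nth algebra_simps sum.distrib)

lemma bm_app_neg [simp]: "bm_app (bm_neg X) x = - bm_app X x"
  by (simp add: bm_neg_def vec_eq_iff bm_app_nth flip: sum_negf)

lemma bm_app_sub [simp]: "bm_app (bm_sub X Y) x = bm_app X x - bm_app Y x"
  by (simp add: bm_sub_def)

lemma bm_app_id [simp]: "bm_app bm_id x = x"
  by (simp add: bm_id_def bm_app_def cmat_def zero_vec_def matrix_vector_mult_def mat_def vec_eq_iff
      if_distrib if_distribR cong: if_cong)

lemma cvec_matrix_vector_mult: "cvec (A *v x) = cmat A *v cvec x"
  by (simp add: cvec_def matrix_vector_mult_def vec_eq_iff)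

lemma cmat_matrix_mult: "cmat (A ** B) = cmat A ** cmat B"
  by (simp add: cmat_def matrix_matrix_mult_def vec_eq_iff)

lemma cmat_add: "cmat (A + B) = cmat A + cmat B"
  by (simp add: cmat_def vec_eq_iff)

lemma cvec_add: "cvec (x + y) = cvec x + cvec y"
  by (simp add: cvec_def vec_eq_iff)

lemma cvec_cvec [simp]: "cvec (cvec x) = x"
  by (simp add: cvec_def)

lemma bm_app_mult [simp]: "bm_app (bm_mult X Y) x = bm_app X (bm_app Y x)"
  by (simp add: bm_app_def bm_mult_def cvec_matrix_vector_mult cmat_matrix_mult cmat_add cvec_add
      matrix_vector_mult_add_rdistrib matrix_vector_right_distrib matrix_vector_mul_assoc)

text \<open>The inner product is the real part of the Hermitian one, and a number and its conjugate
  have equal real parts. Hence the antilinear part is moved across by a transpose without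
  conjugation, which is the second component of \<open>bm_H\<close>.\<close>

lemma inner_bm_app_H: "x \<bullet> bm_app (bm_H X) y = bm_app X x \<bullet> y"
proof -
  have "x \<bullet> bm_app (bm_H X) y =
      (\<Sum>j\<in>UNIV. \<Sum>i\<in>UNIV. (fst X $ i $ j * x $ j + cnj (snd X $ i $ j) * cnj (x $ j)) \<bullet> (y $ i))"
    unfolding inner_vec_def bm_app_nth inner_sum_right
    by (simp add: bm_H_def transpose_def inner_complex_def algebra_simps)
  also have "\<dots> = bm_app X x \<bullet> y"
    by (subst sum.swap) (simp add: inner_vec_def bm_app_nth inner_sum_left)
  finally show ?thesis .
qed

lemma bm_app_axis: "bm_app X (axis j c) $ i = fst X $ i $ j * c + cnj (snd X $ i $ j) * cnj c"
proof -
  have "bm_app X (axis j c) $ i =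
      (\<Sum>k\<in>UNIV. if k = j then fst X $ i $ j * c + cnj (snd X $ i $ j) * cnj c else 0)"
    unfolding bm_app_nth by (rule sum.cong) (auto simp: axis_def)
  then show ?thesis by simp
qed

text \<open>The values at \<open>axis j 1\<close> and \<open>axis j \<i>\<close> are the sum of the
  two coefficients and \<open>\<i>\<close> times their difference (the second one conjugated), which
  determines both. So equality as maps is equality of pairs, and uniqueness of \<open>P\<close> can
  be asserted for the pair itself.\<close>

lemma bm_app_inject: "bm_app X = bm_app Y \<longleftrightarrow> X = Y"
proof
  assume eq: "bm_app X = bm_app Y"
  have "fst X $ i $ j = fst Y $ i $ j \<and> snd X $ i $ j = snd Y $ i $ j" for i j
  proof -
    have "bm_app X (axis j 1) $ i = bm_app Y (axis j 1) $ i"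
      "bm_app X (axis j \<i>) $ i = bm_app Y (axis j \<i>) $ i" using eq by simp_all
    then show ?thesis
      by (simp add: bm_app_axis complex_eq_iff)
  qed
  then show "X = Y" by (simp add: prod_eq_iff vec_eq_iff)
qed simp

lemma ex_bm_app:
  fixes f :: "complex^'m::finite \<Rightarrow> complex^'n::finite"
  assumes "linear f"
  obtains X where "bm_app X = f"
proof
  define a b where "a i j = f (axis j 1) $ i" and "b i j = f (axis j \<i>) $ i" for i j
  \<comment> \<open>The complex-linear and antilinear parts of a real-linear map are
    \<open>(f x - \<i> * f (\<i> x)) / 2\<close> and \<open>(f x + \<i> * f (\<i> x)) / 2\<close>;
    the second is conjugated because \<open>bm_app\<close> conjugates it again.\<close>
  let ?X = "(\<chi> i j. (a i j - \<i> * b i j) / 2, \<chi> i j. cnj ((a i j + \<i> * b i j) / 2))"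
  show "bm_app ?X = f"
  proof (rule linear_eq_stdbasis)
    fix e :: "complex^'m" assume "e \<in> Basis"
    then obtain j where j: "e = axis j 1 \<or> e = axis j \<i>"
      by (auto simp: Basis_vec_def Basis_complex_def)
    have "bm_app ?X (axis j 1) = f (axis j 1)"
      by (simp add: vec_eq_iff bm_app_axis a_def[symmetric] field_simps)
    moreover have "bm_app ?X (axis j \<i>) = f (axis j \<i>)"
      by (simp add: vec_eq_iff bm_app_axis b_def[symmetric] field_simps)
    ultimately show "bm_app ?X e = f e"
      using j by blast
  qed (use assms linear_bm_app in auto)
qed

definition self_adjoint :: "('a::real_inner \<Rightarrow> 'a) \<Rightarrow> bool" where
  "self_adjoint P \<longleftrightarrow> linear P \<and> (\<forall>x y. P x \<bullet> y = x \<bullet> P y)"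

definition pos_def :: "('a::real_inner \<Rightarrow> 'a) \<Rightarrow> bool" where
  "pos_def P \<longleftrightarrow> self_adjoint P \<and> (\<forall>x. x \<noteq> 0 \<longrightarrow> 0 < x \<bullet> P x)"

text \<open>The two symmetry conditions on the components together say \<open>bm_H P = P\<close>,
  that is, self-adjointness of the real-linear map.\<close>

lemma bm_pos_def_iff: "bm_pos_def P \<longleftrightarrow> pos_def (bm_app P)"
proof -
  have "transpose (cmat (fst P)) = fst P \<and> transpose (snd P) = snd P \<longleftrightarrow> bm_H P = P"
    by (simp add: bm_H_def prod_eq_iff)
  also have "\<dots> \<longleftrightarrow> (\<forall>x y. x \<bullet> bm_app (bm_H P) y = x \<bullet> bm_app P y)"
    by (metis bm_app_inject ext vector_eq_ldot)
  also have "\<dots> \<longleftrightarrow> self_adjoint (bm_app P)"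
    by (simp add: inner_bm_app_H self_adjoint_def linear_bm_app)
  finally show ?thesis
    by (auto simp: bm_pos_def_def pos_def_def Re_cinner)
qed

text \<open>In finite dimension an injective map has a linear two-sided inverse, and this inverse is
  again a bimatrix; thus the choice in \<open>bm_inv\<close> is made from a nonempty set.\<close>

lemma bm_app_inv:
  assumes "inj (bm_app X)"
  shows "bm_app X (bm_app (bm_inv X) y) = y"
proof -
  obtain g where g: "linear g" "\<And>x. g (bm_app X x) = x" "\<And>x. bm_app X (g x) = x"
    using linear_injective_isomorphism[OF linear_bm_app assms] by blast
  obtain Y where "bm_app Y = g" using g(1) by (rule ex_bm_app)
  then have "bm_is_inverse X Y"
    using g by (auto simp: bm_is_inverse_def bm_eq_def)
  then have "bm_is_inverse X (bm_inv X)"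
    unfolding bm_inv_def by (rule someI)
  then show ?thesis by (metis bm_app_id bm_app_mult bm_eq_def bm_is_inverse_def)
qed

lemma linear_bimat:
  fixes T :: "('n::finite,'m::finite) bimat \<Rightarrow> ('k::finite,'l::finite) bimat"
  assumes "\<And>X Y x. bm_app (T (X + Y)) x = bm_app (T X) x + bm_app (T Y) x"
    and "\<And>c X x. bm_app (T (c *\<^sub>R X)) x = c *\<^sub>R bm_app (T X) x"
  shows "linear T"
proof (rule linearI)
  have add: "bm_app (X + Y) x = bm_app X x + bm_app Y x" for X Y :: "('k,'l) bimat" and x
    using bm_app_add[of X Y x] by (simp add: bm_add_def plus_prod_def)
  have scale: "bm_app (c *\<^sub>R X) x = c *\<^sub>R bm_app X x" for c and X :: "('k,'l) bimat" and x
    by (simp add: vec_eq_iff bm_app_nth algebra_simps scaleR_sum_right)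
  show "T (X + Y) = T X + T Y" for X Y
    by (subst bm_app_inject[symmetric]) (simp add: fun_eq_iff assms add)
  show "T (c *\<^sub>R X) = c *\<^sub>R T X" for c X
    by (subst bm_app_inject[symmetric]) (simp add: fun_eq_iff assms scale)
qed

text \<open>Function spaces carry no vector space structure here; bimatrices provide the finite-dimensional
  space in which injectivity implies surjectivity.\<close>

lemma linear_operator_equation_solvable:
  fixes T :: "(complex^'n::finite \<Rightarrow> complex^'n) \<Rightarrow> complex^'n \<Rightarrow> complex^'n"
  assumes lin: "\<And>X. linear X \<Longrightarrow> linear (T X)"
    and add: "\<And>X Y x. linear X \<Longrightarrow> linear Y \<Longrightarrow> T (\<lambda>x. X x + Y x) x = T X x + T Y x"
    and scale: "\<And>c X x. linear X \<Longrightarrow> T (\<lambda>x. c *\<^sub>R X x) x = c *\<^sub>R T X x"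
    and ker: "\<And>X. linear X \<Longrightarrow> (\<And>x. T X x = 0) \<Longrightarrow> X = (\<lambda>x. 0)"
    and W: "linear W"
  obtains X where "linear X" "T X = W"
proof -
  \<comment> \<open>Since every linear map is the action of a bimatrix, \<open>T\<close> can be
    lifted to a map between bimatrices.\<close>
  define T' :: "('n,'n) bimat \<Rightarrow> ('n,'n) bimat" where "T' X = (SOME Y. bm_app Y = T (bm_app X))" for X
  have T': "bm_app (T' X) = T (bm_app X)" for X
    unfolding T'_def by (rule someI_ex) (metis ex_bm_app lin linear_bm_app)
  have appadd: "bm_app (X + Y) = (\<lambda>x. bm_app X x + bm_app Y x)" for X Y :: "('n,'n) bimat"
    using bm_app_add[of X Y] by (simp add: bm_add_def plus_prod_def fun_eq_iff)
  have appscale: "bm_app (c *\<^sub>R X) = (\<lambda>x. c *\<^sub>R bm_app X x)" for c and X :: "('n,'n) bimat"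
    by (simp add: fun_eq_iff vec_eq_iff bm_app_nth algebra_simps scaleR_sum_right)
  have "linear T'"
    by (rule linear_bimat) (simp_all add: T' appadd appscale add scale linear_bm_app)
  moreover have "inj T'"
  proof (subst linear_injective_0[OF \<open>linear T'\<close>], intro allI impI)
    fix X assume "T' X = 0"
    then have "T (bm_app X) x = 0" for x
      by (simp add: T'[symmetric] vec_eq_iff bm_app_nth)
    then have "bm_app X = (\<lambda>x. 0)" by (intro ker linear_bm_app)
    also have "\<dots> = bm_app 0" by (simp add: fun_eq_iff vec_eq_iff bm_app_nth)
    finally show "X = 0" by (simp add: bm_app_inject)
  qed
  ultimately have "surj T'" by (simp add: linear_injective_imp_surjective)
  obtain Y where Y: "bm_app Y = W" using W by (rule ex_bm_app)
  obtain X where "T' X = Y" using \<open>surj T'\<close> by (metis surjD)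
  then show ?thesis using that[of "bm_app X"] T'[of X] Y linear_bm_app[of X] by simp
qed

section \<open>Positive definite operators\<close>

text \<open>The form attains a positive minimum on the compact unit sphere; homogeneity of degree
  two spreads the bound to all vectors.\<close>

lemma pos_def_coercive:
  fixes P :: "'a::euclidean_space \<Rightarrow> 'a"
  assumes "pos_def P"
  obtains c where "c > 0" "\<And>x. c * (norm x)\<^sup>2 \<le> x \<bullet> P x"
proof -
  have lin: "linear P" using assms by (simp add: pos_def_def self_adjoint_def)
  have "continuous_on (sphere 0 1) (\<lambda>x. x \<bullet> P x)"
    by (intro continuous_intros linear_continuous_on linear_conv_bounded_linear[THEN iffD1] lin)
  moreover have "sphere (0::'a) 1 \<noteq> {}" by simp
  ultimately obtain e where e: "e \<in> sphere 0 1" "\<And>y. y \<in> sphere 0 1 \<Longrightarrow> e \<bullet> P e \<le> y \<bullet> P y"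
    using continuous_attains_inf[of "sphere (0::'a) 1" "\<lambda>x. x \<bullet> P x"] by auto
  show ?thesis
  proof
    have "e \<noteq> 0" using e(1) by auto
    then show "0 < e \<bullet> P e" using assms by (simp add: pos_def_def)
    show "e \<bullet> P e * (norm x)\<^sup>2 \<le> x \<bullet> P x" for x
    proof (cases "x = 0")
      case True
      then show ?thesis by simp
    next
      case False
      have x: "x = norm x *\<^sub>R sgn x" by (simp add: sgn_div_norm False)
      have "e \<bullet> P e \<le> sgn x \<bullet> P (sgn x)"
        by (rule e(2)) (simp add: norm_sgn False)
      then have "e \<bullet> P e * (norm x)\<^sup>2 \<le> (sgn x \<bullet> P (sgn x)) * (norm x)\<^sup>2"
        by (rule mult_right_mono) simp
      also have "\<dots> = x \<bullet> P x"
        by (subst (3 4) x) (simp add: linear_scale[OF lin] power2_eq_square)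
      finally show ?thesis .
    qed
  qed
qed

lemma inj_pos_def: "pos_def P \<Longrightarrow> inj P"
  unfolding pos_def_def self_adjoint_def
  by (metis inner_zero_right less_irrefl linear_injective_0)

text \<open>Polarization: expanding the form at \<open>x + y\<close> recovers
  \<open>y \<bullet> P x\<close>. Costs only give quadratic forms, so this is how they determine the
  operator.\<close>

lemma self_adjoint_eqI:
  assumes "self_adjoint P" "self_adjoint P'" and eq: "\<And>x. x \<bullet> P x = x \<bullet> P' x"
  shows "P = P'"
proof
  fix x
  have "y \<bullet> P x = y \<bullet> P' x" for y
  proof -
    have "(x + y) \<bullet> P (x + y) = x \<bullet> P x + y \<bullet> P y + 2 * (y \<bullet> P x)"
      "(x + y) \<bullet> P' (x + y) = x \<bullet> P' x + y \<bullet> P' y + 2 * (y \<bullet> P' x)"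
      using assms(1,2) unfolding self_adjoint_def
      by (auto simp: linear_add inner_add_left inner_add_right) (metis inner_commute)+
    then show ?thesis using eq[of "x + y"] eq[of x] eq[of y] by linarith
  qed
  then show "P x = P' x" by (metis vector_eq_ldot)
qed

lemma self_adjoint_eq_0:
  assumes "self_adjoint M" "\<And>x. x \<bullet> M x = 0"
  shows "M x = 0"
proof -
  have "M = (\<lambda>x. 0)"
    by (rule self_adjoint_eqI[OF assms(1)]) (auto simp: assms(2) self_adjoint_def intro!: linearI)
  then show ?thesis by simp
qed

lemma self_adjoint_quadratic_add:
  assumes "self_adjoint P"
  shows "(x + y) \<bullet> P (x + y) = x \<bullet> P x + 2 * (y \<bullet> P x) + y \<bullet> P y"
  using assms unfolding self_adjoint_def
  by (simp add: linear_add inner_add_left inner_add_right) (metis inner_commute)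

lemma self_adjoint_quadratic_diff:
  assumes "self_adjoint P"
  shows "(x - y) \<bullet> P (x - y) = x \<bullet> P x - 2 * (x \<bullet> P y) + y \<bullet> P y"
  using assms unfolding self_adjoint_def
  by (simp add: linear_diff inner_diff_left inner_diff_right) (metis inner_commute)

section \<open>Positive semidefinite operators and monotone limits\<close>

definition psd :: "('a::real_inner \<Rightarrow> 'a) \<Rightarrow> bool" where
  "psd P \<longleftrightarrow> self_adjoint P \<and> (\<forall>x. 0 \<le> x \<bullet> P x)"

lemma psd_self_adjoint: "psd P \<Longrightarrow> self_adjoint P"
  and psd_nonneg: "psd P \<Longrightarrow> 0 \<le> x \<bullet> P x"
  by (simp_all add: psd_def)

lemma pos_def_psd: "pos_def P \<Longrightarrow> psd P"
  unfolding pos_def_def psd_def by (metis inner_zero_left less_eq_real_def)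

lemma pos_def_pos: "pos_def P \<Longrightarrow> x \<noteq> 0 \<Longrightarrow> 0 < x \<bullet> P x"
  by (simp add: pos_def_def)

lemma self_adjoint_linear: "self_adjoint P \<Longrightarrow> linear P"
  by (simp add: self_adjoint_def)

lemma self_adjoint_commute: "self_adjoint P \<Longrightarrow> y \<bullet> P x = x \<bullet> P y"
  unfolding self_adjoint_def by (metis inner_commute)

lemmas psd_linear = self_adjoint_linear[OF psd_self_adjoint]
lemmas pos_def_self_adjoint = psd_self_adjoint[OF pos_def_psd]
lemmas pos_def_linear = self_adjoint_linear[OF pos_def_self_adjoint]
lemmas pos_def_nonneg = psd_nonneg[OF pos_def_psd]

lemma pos_def_eq_0: "pos_def P \<Longrightarrow> x \<bullet> P x = 0 \<longleftrightarrow> x = 0"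
  by (metis inner_zero_left less_irrefl pos_def_pos)

text \<open>If \<open>P x\<close> were nonzero, moving from \<open>x\<close> a short way in the
  direction \<open>- P x\<close> would make the form negative.\<close>

lemma psd_eq_0:
  fixes P :: "'a::real_inner \<Rightarrow> 'a"
  assumes "psd P" and 0: "x \<bullet> P x = 0"
  shows "P x = 0"
proof (rule ccontr)
  assume "P x \<noteq> 0"
  define a m where "a = P x \<bullet> P x" and "m = P x \<bullet> P (P x)"
  have "a > 0" "m \<ge> 0" using \<open>P x \<noteq> 0\<close> psd_nonneg[OF assms(1)] by (simp_all add: a_def m_def)
  \<comment> \<open>Near the minimizer of the quadratic in \<open>t\<close>; the added 1 keeps the
    denominator positive when \<open>m = 0\<close> and still gives
    \<open>t * m \<le> a\<close>.\<close>
  define t where "t = a / (m + 1)"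
  have "t > 0" using \<open>a > 0\<close> \<open>m \<ge> 0\<close> by (simp add: t_def)
  have "0 \<le> (x - t *\<^sub>R P x) \<bullet> P (x - t *\<^sub>R P x)" using assms(1) by (rule psd_nonneg)
  also have "\<dots> = x \<bullet> P x - 2 * t * a + t * (t * m)"
    using self_adjoint_commute[OF psd_self_adjoint[OF assms(1)], of "x" "P x"]
    by (simp add: linear_diff linear_scale psd_linear[OF assms(1)] inner_diff_left inner_diff_right
        a_def m_def algebra_simps inner_commute)
  also have "\<dots> = t * (t * m - 2 * a)" by (simp add: 0 algebra_simps)
  finally have "2 * a \<le> t * m" using \<open>t > 0\<close> by (simp add: zero_le_mult_iff)
  also have "t * m \<le> t * (m + 1)" using \<open>t > 0\<close> by simp
  also have "\<dots> = a" using \<open>m \<ge> 0\<close> by (simp add: t_def)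
  finally show False using \<open>a > 0\<close> by simp
qed

text \<open>Solutions of linear operator equations come without symmetry; averaging with the adjoint
  restores it and leaves the quadratic form unchanged.\<close>

lemma symmetric_part:
  fixes X :: "'a::euclidean_space \<Rightarrow> 'a"
  assumes "linear X"
  obtains P where "self_adjoint P" "\<And>x. x \<bullet> P x = x \<bullet> X x"
proof
  let ?P = "\<lambda>x. (1/2) *\<^sub>R (X x + adjoint X x)"
  have "linear ?P"
    by (intro linear_compose_scale_right linear_compose_add assms adjoint_linear)
  then show "self_adjoint ?P"
    by (simp add: self_adjoint_def inner_add_left inner_add_right adjoint_clauses[OF assms])
  show "x \<bullet> ?P x = x \<bullet> X x" for x
    by (simp add: inner_add_right adjoint_clauses[OF assms] inner_commute)
qed

text \<open>Each \<open>x \<bullet> P k x\<close> decreases and is bounded below by 0. Polarization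
  carries convergence over to every \<open>y \<bullet> P k x\<close>, and the coordinates with
  respect to the basis assemble the limit operator.\<close>

lemma decreasing_psd_limit:
  fixes P :: "nat \<Rightarrow> 'a::euclidean_space \<Rightarrow> 'a"
  assumes psd: "\<And>k. psd (P k)" and dec: "\<And>k x. x \<bullet> P (Suc k) x \<le> x \<bullet> P k x"
  obtains L where "psd L" "\<And>x. (\<lambda>k. P k x) \<longlonglongrightarrow> L x"
proof -
  have lin: "linear (P k)" for k by (rule psd_linear[OF psd])
  have quad: "convergent (\<lambda>k. x \<bullet> P k x)" for x
  proof -
    have "decseq (\<lambda>k. x \<bullet> P k x)" using dec by (simp add: decseq_Suc_iff)
    then obtain l where "(\<lambda>k. x \<bullet> P k x) \<longlonglongrightarrow> l"
      using decseq_convergent psd_nonneg[OF psd] by metis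
    then show ?thesis by (rule convergentI)
  qed
  have "convergent (\<lambda>k. y \<bullet> P k x)" for x y
  proof -
    have "y \<bullet> P k x = 1/4 * ((x + y) \<bullet> P k (x + y) - (x - y) \<bullet> P k (x - y))" for k
      using self_adjoint_commute[OF psd_self_adjoint[OF psd], of y k x]
      by (simp add: linear_add[OF lin] linear_diff[OF lin] inner_add_left inner_add_right
          inner_diff_left inner_diff_right)
    moreover have "convergent (\<lambda>k. 1/4 * ((x + y) \<bullet> P k (x + y) - (x - y) \<bullet> P k (x - y)))"
      by (intro convergent_mult convergent_diff convergent_const quad)
    ultimately show ?thesis by (simp only:)
  qed
  then have l: "(\<lambda>k. y \<bullet> P k x) \<longlonglongrightarrow> lim (\<lambda>k. y \<bullet> P k x)" for x y
    by (simp add: convergent_LIMSEQ_iff)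
  define L where "L x = (\<Sum>b\<in>Basis. lim (\<lambda>k. b \<bullet> P k x) *\<^sub>R b)" for x
  have L: "(\<lambda>k. P k x) \<longlonglongrightarrow> L x" for x
  proof -
    have "(\<lambda>k. \<Sum>b\<in>Basis. (b \<bullet> P k x) *\<^sub>R b) \<longlonglongrightarrow> L x"
      unfolding L_def by (intro tendsto_intros l)
    then show ?thesis
      by (simp add: inner_commute[of _ "P _ x"] euclidean_representation)
  qed
  have "linear L"
  proof (rule linearI)
    show "L (x + y) = L x + L y" for x y
      using LIMSEQ_unique[OF L[of "x + y"]] tendsto_add[OF L[of x] L[of y]]
      by (simp add: linear_add[OF lin])
    show "L (c *\<^sub>R x) = c *\<^sub>R L x" for c x
      using LIMSEQ_unique[OF L[of "c *\<^sub>R x"]] tendsto_scaleR[OF tendsto_const L[of x], of c]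
      by (simp add: linear_scale[OF lin])
  qed
  moreover have "L x \<bullet> y = x \<bullet> L y" for x y
  proof (rule LIMSEQ_unique)
    show "(\<lambda>k. P k x \<bullet> y) \<longlonglongrightarrow> L x \<bullet> y" by (intro tendsto_intros L)
    have "(\<lambda>k. x \<bullet> P k y) \<longlonglongrightarrow> x \<bullet> L y" by (intro tendsto_intros L)
    then show "(\<lambda>k. P k x \<bullet> y) \<longlonglongrightarrow> x \<bullet> L y"
      using psd by (simp add: psd_def self_adjoint_def)
  qed
  moreover have "0 \<le> x \<bullet> L x" for x
  proof (rule LIMSEQ_le_const)
    show "(\<lambda>k. x \<bullet> P k x) \<longlonglongrightarrow> x \<bullet> L x" by (intro tendsto_intros L)
  qed (use psd_nonneg[OF psd] in auto)
  ultimately have "psd L" by (simp add: psd_def self_adjoint_def)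
  then show ?thesis using L by (rule that)
qed

lemma tendsto_zero_pos_def:
  fixes P :: "'a::euclidean_space \<Rightarrow> 'a"
  assumes "pos_def P" "((\<lambda>t. x t \<bullet> P (x t)) \<longlongrightarrow> 0) F"
  shows "(x \<longlongrightarrow> 0) F"
proof -
  obtain c where c: "c > 0" "\<And>x. c * (norm x)\<^sup>2 \<le> x \<bullet> P x"
    using pos_def_coercive[OF assms(1)] by blast
  have "((\<lambda>t. (norm (x t))\<^sup>2) \<longlongrightarrow> 0) F"
  proof (rule tendsto_sandwich[OF _ _ tendsto_const])
    show "((\<lambda>t. (x t \<bullet> P (x t)) / c) \<longlongrightarrow> 0) F"
      using tendsto_divide[OF assms(2) tendsto_const, of c] c(1) by simp
  qed (use c in \<open>auto simp: field_simps\<close>)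
  then have "((\<lambda>t. sqrt ((norm (x t))\<^sup>2)) \<longlongrightarrow> sqrt 0) F" by (rule tendsto_real_sqrt)
  then show ?thesis by (simp add: tendsto_norm_zero_iff)
qed

lemma tendsto_quadratic_zero:
  fixes P :: "'a::euclidean_space \<Rightarrow> 'b::euclidean_space"
  assumes "linear P" "(x \<longlongrightarrow> 0) F" "(y \<longlongrightarrow> 0) F"
  shows "((\<lambda>t. y t \<bullet> P (x t)) \<longlongrightarrow> 0) F"
proof -
  have "((\<lambda>t. P (x t)) \<longlongrightarrow> P 0) F"
    using assms(1,2) by (simp add: bounded_linear.tendsto linear_conv_bounded_linear)
  then show ?thesis using tendsto_inner[OF assms(3)] linear_0[OF assms(1)] by fastforce
qed

lemma psd_congruence:
  fixes K :: "'c::euclidean_space \<Rightarrow> 'd::euclidean_space"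
  assumes "psd P" "linear K"
  shows "psd (\<lambda>x. adjoint K (P (K x)))" "x \<bullet> adjoint K (P (K x)) = K x \<bullet> P (K x)"
proof -
  have "linear (\<lambda>x. adjoint K (P (K x)))"
    using linear_compose[OF linear_compose[OF assms(2) psd_linear[OF assms(1)]] adjoint_linear[OF assms(2)]]
    by (simp add: o_def)
  moreover have "adjoint K (P (K x)) \<bullet> y = x \<bullet> adjoint K (P (K y))" for x y
    using assms(1) by (simp add: adjoint_clauses[OF assms(2)] psd_def self_adjoint_def)
  ultimately show "psd (\<lambda>x. adjoint K (P (K x)))"
    using assms(1) by (simp add: psd_def self_adjoint_def adjoint_clauses[OF assms(2)])
  show "x \<bullet> adjoint K (P (K x)) = K x \<bullet> P (K x)"
    by (simp add: adjoint_clauses[OF assms(2)])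
qed

lemma psd_add: "psd P \<Longrightarrow> psd P' \<Longrightarrow> psd (\<lambda>x. P x + P' x)"
  by (auto simp: psd_def self_adjoint_def inner_add_left inner_add_right intro: linear_compose_add)

section \<open>The discrete-time regulator\<close>

text \<open>The theory lives on arbitrary Euclidean spaces. Only the results that solve a linear
  operator equation are stated for complex vectors, since that argument passes through
  bimatrices.\<close>

locale lqr =
  fixes A :: "'a::euclidean_space \<Rightarrow> 'a" and B :: "'b::euclidean_space \<Rightarrow> 'a"
    and Q :: "'a \<Rightarrow> 'a" and R :: "'b \<Rightarrow> 'b"
  assumes A: "linear A" and B: "linear B" and Q: "pos_def Q" and R: "pos_def R"
begin

definition cost :: "'a \<Rightarrow> 'b \<Rightarrow> real" where
  "cost x u = x \<bullet> Q x + u \<bullet> R u"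

lemma cost_nonneg: "0 \<le> cost x u"
  by (simp add: cost_def pos_def_nonneg Q R)

lemma cost_ge_state: "x \<bullet> Q x \<le> cost x u"
  by (simp add: cost_def pos_def_nonneg R)

section \<open>Completion of squares and optimality in discrete time\<close>

definition dt_opt_gain :: "('a \<Rightarrow> 'a) \<Rightarrow> ('a \<Rightarrow> 'b) \<Rightarrow> bool" where
  "dt_opt_gain P K \<longleftrightarrow> linear K \<and> (\<forall>x u. u \<bullet> R (K x) + B u \<bullet> P (B (K x)) = - (B u \<bullet> P (A x)))"

text \<open>The Bellman equation evaluated at its minimizing input. Its agreement with the algebraic
  Riccati equation is \<open>dt_riccati_iff\<close>.\<close>

definition dt_riccati :: "('a \<Rightarrow> 'a) \<Rightarrow> ('a \<Rightarrow> 'b) \<Rightarrow> bool" where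
  "dt_riccati P K \<longleftrightarrow> dt_opt_gain P K \<and>
     (\<forall>x. x \<bullet> P x = cost x (K x) + (A x + B (K x)) \<bullet> P (A x + B (K x)))"

text \<open>As a function of \<open>u\<close> the right-hand side of the Bellman equation is a
  quadratic with Hessian \<open>R\<close> plus the congruence of \<open>P\<close> by
  \<open>B\<close>. The gain condition, tested with \<open>u\<close> and with \<open>K x\<close>,
  cancels the cross terms.\<close>

lemma dt_complete_square:
  assumes "self_adjoint P" "dt_opt_gain P K"
  shows "cost x u + (A x + B u) \<bullet> P (A x + B u) =
    cost x (K x) + (A x + B (K x)) \<bullet> P (A x + B (K x)) +
    ((u - K x) \<bullet> R (u - K x) + B (u - K x) \<bullet> P (B (u - K x)))"
proof -
  have "u \<bullet> R (K x) + B u \<bullet> P (B (K x)) = - (B u \<bullet> P (A x))"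
    "K x \<bullet> R (K x) + B (K x) \<bullet> P (B (K x)) = - (B (K x) \<bullet> P (A x))"
    using assms(2) by (auto simp: dt_opt_gain_def)
  then show ?thesis
    unfolding cost_def linear_diff[OF B] self_adjoint_quadratic_add[OF assms(1)]
      self_adjoint_quadratic_diff[OF assms(1)]
      self_adjoint_quadratic_diff[OF pos_def_self_adjoint[OF R]]
    by linarith
qed

lemma dt_trajectory_sum:
  assumes P: "self_adjoint P" and ric: "dt_riccati P K"
    and x: "\<And>t. x (Suc t) = A (x t) + B (u t)"
  shows "(\<Sum>t<N. cost (x t) (u t)) + x N \<bullet> P (x N) = x 0 \<bullet> P (x 0) +
    (\<Sum>t<N. (u t - K (x t)) \<bullet> R (u t - K (x t)) + B (u t - K (x t)) \<bullet> P (B (u t - K (x t))))"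
proof (induction N)
  case (Suc N)
  have "x N \<bullet> P (x N) = cost (x N) (K (x N)) +
      (A (x N) + B (K (x N))) \<bullet> P (A (x N) + B (K (x N)))"
    and "dt_opt_gain P K" using ric unfolding dt_riccati_def by blast+
  then show ?case
    using dt_complete_square[OF P, of K "x N" "u N"] Suc.IH by (simp add: x)
qed simp

lemma dt_closed_loop_stable:
  assumes P: "pos_def P" and ric: "dt_riccati P K"
    and x: "\<And>t. x (Suc t) = A (x t) + B (K (x t))"
  shows "x \<longlonglongrightarrow> 0"
proof (rule tendsto_zero_pos_def[OF Q])
  have "(\<Sum>t<N. cost (x t) (K (x t))) \<le> x 0 \<bullet> P (x 0)" for N
    using dt_trajectory_sum[where u = "\<lambda>t. K (x t)", OF pos_def_self_adjoint[OF P] ric x, of N] pos_def_nonneg[OF P, of "x N"]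
    by (simp add: linear_0[OF B])
  then have "summable (\<lambda>t. cost (x t) (K (x t)))"
    by (intro summableI_nonneg_bounded cost_nonneg)
  then show "(\<lambda>t. x t \<bullet> Q (x t)) \<longlonglongrightarrow> 0"
    by (intro tendsto_sandwich[OF _ _ tendsto_const summable_LIMSEQ_zero])
       (auto simp: pos_def_nonneg Q cost_ge_state)
qed

lemma dt_closed_loop_cost:
  assumes P: "pos_def P" and ric: "dt_riccati P K"
    and x: "\<And>t. x (Suc t) = A (x t) + B (K (x t))"
  shows "(\<Sum>t. ennreal (cost (x t) (K (x t)))) = ennreal (x 0 \<bullet> P (x 0))"
proof -
  have "(\<lambda>N. x 0 \<bullet> P (x 0) - x N \<bullet> P (x N)) \<longlonglongrightarrow> x 0 \<bullet> P (x 0) - 0"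
    by (intro tendsto_intros tendsto_quadratic_zero dt_closed_loop_stable[where x = x, OF P ric x] pos_def_linear P)
  moreover have "x 0 \<bullet> P (x 0) - x N \<bullet> P (x N) = (\<Sum>t<N. cost (x t) (K (x t)))" for N
    using dt_trajectory_sum[where u = "\<lambda>t. K (x t)", OF pos_def_self_adjoint[OF P] ric x, of N]
    by (simp add: linear_0[OF B])
  ultimately have "(\<lambda>t. cost (x t) (K (x t))) sums (x 0 \<bullet> P (x 0))"
    by (simp add: sums_def)
  then show ?thesis
    by (intro suminf_ennreal_eq cost_nonneg)
qed

text \<open>Infinite cost satisfies the bound trivially. Otherwise summability of the
  \<open>Q\<close>-part drives the state to 0 under any control, so the summed identity passes to
  the limit: the excess over \<open>x 0 \<bullet> P (x 0)\<close> is exactly the series of the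
  nonnegative \<open>e t\<close>. Zero excess makes every term vanish, and the \<open>R\<close>-part
  of \<open>e t\<close> then forces the feedback law.\<close>

lemma dt_cost_lower_bound:
  assumes P: "pos_def P" and ric: "dt_riccati P K"
    and x: "\<And>t. x (Suc t) = A (x t) + B (u t)"
  shows "ennreal (x 0 \<bullet> P (x 0)) \<le> (\<Sum>t. ennreal (cost (x t) (u t)))"
    and "(\<Sum>t. ennreal (cost (x t) (u t))) = ennreal (x 0 \<bullet> P (x 0)) \<Longrightarrow> u t = K (x t)"
proof -
  define e where "e t = (u t - K (x t)) \<bullet> R (u t - K (x t)) +
    B (u t - K (x t)) \<bullet> P (B (u t - K (x t)))" for t
  have e: "0 \<le> e t" "(u t - K (x t)) \<bullet> R (u t - K (x t)) \<le> e t" for t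
    by (simp_all add: e_def pos_def_nonneg P R)
  have main: "\<exists>J. (\<Sum>t. ennreal (cost (x t) (u t))) = ennreal J \<and> 0 \<le> J \<and> e sums (J - x 0 \<bullet> P (x 0))"
    if fin: "(\<Sum>t. ennreal (cost (x t) (u t))) \<noteq> top"
  proof -
    have sm: "summable (\<lambda>t. cost (x t) (u t))"
      using cost_nonneg fin by (rule summable_suminf_not_top)
    define J where "J = (\<Sum>t. cost (x t) (u t))"
    have "(\<lambda>t. x t \<bullet> Q (x t)) \<longlonglongrightarrow> 0"
      by (intro tendsto_sandwich[OF _ _ tendsto_const summable_LIMSEQ_zero[OF sm]])
         (auto simp: pos_def_nonneg Q cost_ge_state)
    then have "x \<longlonglongrightarrow> 0" by (rule tendsto_zero_pos_def[OF Q])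
    then have "(\<lambda>N. (\<Sum>t<N. cost (x t) (u t)) + x N \<bullet> P (x N) - x 0 \<bullet> P (x 0))
        \<longlonglongrightarrow> J + 0 - x 0 \<bullet> P (x 0)"
      unfolding J_def
      by (intro tendsto_intros tendsto_quadratic_zero summable_LIMSEQ sm pos_def_linear P)
    moreover have "(\<Sum>t<N. cost (x t) (u t)) + x N \<bullet> P (x N) - x 0 \<bullet> P (x 0) = (\<Sum>t<N. e t)" for N
      using dt_trajectory_sum[where u = u, OF pos_def_self_adjoint[OF P] ric x, of N] by (simp add: e_def)
    ultimately have "e sums (J - x 0 \<bullet> P (x 0))"
      by (simp add: sums_def)
    moreover have "(\<Sum>t. ennreal (cost (x t) (u t))) = ennreal J" "0 \<le> J"
      unfolding J_def by (auto intro!: suminf_ennreal2 cost_nonneg sm suminf_nonneg)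
    ultimately show ?thesis by blast
  qed
  show "ennreal (x 0 \<bullet> P (x 0)) \<le> (\<Sum>t. ennreal (cost (x t) (u t)))"
  proof (cases "(\<Sum>t. ennreal (cost (x t) (u t))) = top")
    case False
    then obtain J where J: "(\<Sum>t. ennreal (cost (x t) (u t))) = ennreal J"
      "e sums (J - x 0 \<bullet> P (x 0))" using main by blast
    then have "0 \<le> J - x 0 \<bullet> P (x 0)" using sums_le[OF _ sums_zero J(2)] e(1) by simp
    then show ?thesis using J(1) by (simp add: ennreal_leI)
  qed simp
  assume eq: "(\<Sum>t. ennreal (cost (x t) (u t))) = ennreal (x 0 \<bullet> P (x 0))"
  then obtain J where J: "ennreal (x 0 \<bullet> P (x 0)) = ennreal J" "0 \<le> J"
    "e sums (J - x 0 \<bullet> P (x 0))" using main by auto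
  then have "e sums 0" using pos_def_nonneg[OF P, of "x 0"] by (simp add: ennreal_inj)
  then have "summable e" "(\<Sum>t. e t) = 0" by (simp_all add: sums_iff)
  then have "e t = 0" using e(1) by (simp add: suminf_eq_zero_iff)
  then have "(u t - K (x t)) \<bullet> R (u t - K (x t)) = 0"
    using e(2)[of t] pos_def_nonneg[OF R, of "u t - K (x t)"] by linarith
  then show "u t = K (x t)" by (simp add: pos_def_eq_0 R)
qed

text \<open>The closed loop of either solution is an admissible trajectory for the lower bound of
  the other; the two inequalities give equal quadratic forms.\<close>

lemma dt_riccati_unique:
  assumes "pos_def P" "dt_riccati P K" "pos_def P'" "dt_riccati P' K'"
  shows "P = P'"
proof -
  have le: "x0 \<bullet> P' x0 \<le> x0 \<bullet> P x0"
    if "pos_def P" "dt_riccati P K" "pos_def P'" "dt_riccati P' K'" for P K P' K' x0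
  proof -
    define x where "x t = ((\<lambda>x. A x + B (K x)) ^^ t) x0" for t
    have x: "x (Suc t) = A (x t) + B (K (x t))" "x 0 = x0" for t by (simp_all add: x_def)
    have "ennreal (x0 \<bullet> P' x0) \<le> ennreal (x0 \<bullet> P x0)"
      using dt_cost_lower_bound(1)[where u = "\<lambda>t. K (x t)" and x = x, OF that(3,4) x(1)]
        dt_closed_loop_cost[where x = x, OF that(1,2) x(1)] x(2)
      by simp
    then show ?thesis using pos_def_nonneg[OF that(1)] by (simp add: ennreal_le_iff)
  qed
  show ?thesis
    by (rule self_adjoint_eqI) (use le assms in \<open>auto intro!: pos_def_self_adjoint order_antisym\<close>)
qed

section \<open>Bellman operator and value iteration\<close>

lemma dt_opt_gain_exists:
  assumes P: "psd P"
  obtains K where "dt_opt_gain P K"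
proof -
  define S where "S u = R u + adjoint B (P (B u))" for u
  have lins: "linear R" "linear P" "linear (adjoint B)"
    using R P B by (simp_all add: pos_def_linear psd_linear adjoint_linear)
  have S: "linear S"
    unfolding S_def
    by (rule linearI) (simp_all add: linear_add[OF lins(1)] linear_add[OF lins(2)] linear_add[OF lins(3)]
        linear_add[OF B] linear_scale[OF lins(1)] linear_scale[OF lins(2)] linear_scale[OF lins(3)]
        linear_scale[OF B] algebra_simps)
  have "inj S"
  proof (subst linear_injective_0[OF S], intro allI impI)
    fix u assume "S u = 0"
    then have "0 = u \<bullet> S u" by simp
    also have "\<dots> = u \<bullet> R u + B u \<bullet> P (B u)"
      by (simp add: S_def inner_add_right adjoint_works[OF B])
    finally have "u \<bullet> R u \<le> 0" using psd_nonneg[OF P, of "B u"] by linarith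
    then show "u = 0" using R by (metis not_less pos_def_pos)
  qed
  then obtain g where g: "linear g" "\<And>u. S (g u) = u"
    using linear_injective_isomorphism[OF S] by metis
  define K where "K x = g (- adjoint B (P (A x)))" for x
  have "linear K"
    unfolding K_def
    by (rule linearI) (simp_all add: linear_add[OF lins(2)] linear_add[OF lins(3)] linear_add[OF A]
        linear_diff[OF g(1)]  linear_neg[OF g(1)] linear_add[OF g(1)] linear_scale[OF g(1)]
        linear_scale[OF lins(2)] linear_scale[OF lins(3)] linear_scale[OF A])
  moreover have "u \<bullet> R (K x) + B u \<bullet> P (B (K x)) = - (B u \<bullet> P (A x))" for x u
  proof -
    have "u \<bullet> R (K x) + B u \<bullet> P (B (K x)) = u \<bullet> S (K x)"
      by (simp add: S_def inner_add_right adjoint_works[OF B])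
    also have "S (K x) = - adjoint B (P (A x))" by (simp add: K_def g(2))
    finally show ?thesis by (simp add: adjoint_works[OF B])
  qed
  ultimately show ?thesis using that unfolding dt_opt_gain_def by blast
qed

definition dt_gain_of :: "('a \<Rightarrow> 'a) \<Rightarrow> 'a \<Rightarrow> 'b" where
  "dt_gain_of P = (SOME K. dt_opt_gain P K)"

lemma dt_opt_gain_of: "psd P \<Longrightarrow> dt_opt_gain P (dt_gain_of P)"
  unfolding dt_gain_of_def by (erule dt_opt_gain_exists) (rule someI[where P = "dt_opt_gain P"])

text \<open>One step of value iteration in the so-called Joseph form: a sum of \<open>Q\<close> and
  congruences of \<open>R\<close> and \<open>P\<close>. Positive semidefiniteness is visible here,
  unlike in the form with a subtracted inverse term.\<close>

definition bellman :: "('a \<Rightarrow> 'a) \<Rightarrow> 'a \<Rightarrow> 'a" where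
  "bellman P = (let K = dt_gain_of P; F = \<lambda>x. A x + B (K x) in
     (\<lambda>x. Q x + adjoint K (R (K x)) + adjoint F (P (F x))))"

lemma bellman:
  assumes P: "psd P"
  shows "psd (bellman P)"
    and "x \<bullet> bellman P x = cost x (dt_gain_of P x) +
      (A x + B (dt_gain_of P x)) \<bullet> P (A x + B (dt_gain_of P x))"
proof -
  define K where "K = dt_gain_of P"
  have K: "linear K" using dt_opt_gain_of[OF P] by (simp add: K_def dt_opt_gain_def)
  have F: "linear (\<lambda>x. A x + B (K x))"
    using linear_compose_add[OF A linear_compose[OF K B]] by (simp add: o_def)
  have eq: "bellman P = (\<lambda>x. Q x + adjoint K (R (K x)) +
      adjoint (\<lambda>x. A x + B (K x)) (P (A x + B (K x))))"
    by (simp add: bellman_def Let_def K_def)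
  show "psd (bellman P)"
    unfolding eq
    by (intro psd_add psd_congruence(1)[OF P F] psd_congruence(1)[OF pos_def_psd[OF R] K] pos_def_psd Q)
  show "x \<bullet> bellman P x = cost x (dt_gain_of P x) +
      (A x + B (dt_gain_of P x)) \<bullet> P (A x + B (dt_gain_of P x))"
    unfolding eq K_def[symmetric]
    by (simp add: inner_add_right psd_congruence(2)[OF P F]
        psd_congruence(2)[OF pos_def_psd[OF R] K] cost_def)
qed

lemma bellman_le:
  assumes P: "psd P"
  shows "x \<bullet> bellman P x \<le> cost x u + (A x + B u) \<bullet> P (A x + B u)"
  using dt_complete_square[OF psd_self_adjoint[OF P] dt_opt_gain_of[OF P], of x u]
    psd_nonneg[OF P, of "B (u - dt_gain_of P x)"] pos_def_nonneg[OF R, of "u - dt_gain_of P x"]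
  by (simp add: bellman(2)[OF P])

text \<open>A minimum over inputs inherits monotonicity: the input optimal for \<open>P'\<close> is
  a competitor in the minimum for \<open>P\<close>.\<close>

lemma bellman_mono:
  assumes "psd P" "psd P'" "\<And>x. x \<bullet> P x \<le> x \<bullet> P' x"
  shows "x \<bullet> bellman P x \<le> x \<bullet> bellman P' x"
  unfolding bellman(2)[OF assms(2)]
  by (rule order_trans[OF bellman_le[OF assms(1), where u = "dt_gain_of P' x"]]) (use assms(3) in auto)

text \<open>Coercivity of \<open>R\<close> makes the optimal gain depend continuously on the cost matrix.\<close>

lemma coercive_tendsto:
  fixes v :: "nat \<Rightarrow> 'b" and z :: "nat \<Rightarrow> 'a"
  assumes z: "z \<longlonglongrightarrow> z0"
    and le: "\<And>k. (v k - w) \<bullet> R (v k - w) \<le> - (B (v k - w) \<bullet> (z k - z0))"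
  shows "v \<longlonglongrightarrow> w"
proof -
  obtain c where c: "c > 0" "\<And>u. c * (norm u)\<^sup>2 \<le> u \<bullet> R u"
    using pos_def_coercive[OF R] by blast
  obtain b where b: "b > 0" "\<And>u. norm (B u) \<le> b * norm u"
    using linear_bounded_pos[OF B] by blast
  have bd: "norm (v k - w) \<le> b / c * norm (z k - z0)" for k
  proof (cases "v k = w")
    case False
    let ?d = "v k - w"
    have "c * (norm ?d)\<^sup>2 \<le> norm (B ?d) * norm (z k - z0)"
      using c(2)[of ?d] le[of k] Cauchy_Schwarz_ineq2[of "B ?d" "z k - z0"] by linarith
    also have "\<dots> \<le> b * norm ?d * norm (z k - z0)"
      by (intro mult_right_mono b) simp
    finally have "norm ?d * (c * norm ?d) \<le> norm ?d * (b * norm (z k - z0))"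
      by (simp add: power2_eq_square algebra_simps)
    then have "c * norm ?d \<le> b * norm (z k - z0)"
      using False by simp
    then show ?thesis using c(1) by (simp add: field_simps)
  qed (use b c in simp)
  have "(\<lambda>k. z k - z0) \<longlonglongrightarrow> 0" using z by (simp add: LIM_zero)
  then have "(\<lambda>k. b / c * norm (z k - z0)) \<longlonglongrightarrow> 0"
    by (intro tendsto_mult_right_zero tendsto_norm_zero)
  then have "(\<lambda>k. v k - w) \<longlonglongrightarrow> 0"
    by (rule Lim_null_comparison[rotated]) (use bd in auto)
  then show ?thesis by (rule LIM_zero_cancel)
qed

text \<open>The hypothesis makes \<open>P0\<close> a supersolution, so monotonicity turns its whole
  orbit into a decreasing sequence. Passing to the limit in the Bellman equation requires
  convergence of the gains as well.\<close>

lemma dt_riccati_exists: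
  assumes P0: "psd P0" and dec: "\<And>x. x \<bullet> bellman P0 x \<le> x \<bullet> P0 x"
  obtains P K where "pos_def P" "dt_riccati P K"
proof -
  define P where "P k = (bellman ^^ k) P0" for k
  have P_Suc: "P (Suc k) = bellman (P k)" for k by (simp add: P_def)
  have psd: "psd (P k)" for k
    by (induction k) (simp add: P_def P0, simp add: P_Suc bellman(1))
  have decr: "x \<bullet> P (Suc k) x \<le> x \<bullet> P k x" for k x
  proof (induction k arbitrary: x)
    case 0
    then show ?case using dec by (simp add: P_def)
  next
    case (Suc k)
    then show ?case unfolding P_Suc[of "Suc k"] P_Suc[of k]
      by (intro bellman_mono) (auto simp: bellman(1) psd Suc simp flip: P_Suc)
  qed
  obtain L where L: "psd L" "\<And>x. (\<lambda>k. P k x) \<longlonglongrightarrow> L x"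
    using decreasing_psd_limit[of P, OF psd decr] by blast
  define K where "K = dt_gain_of L"
  have K: "dt_opt_gain L K" unfolding K_def by (rule dt_opt_gain_of[OF L(1)])
  define V where "V k = dt_gain_of (P k)" for k
  have V: "dt_opt_gain (P k) (V k)" for k unfolding V_def by (rule dt_opt_gain_of[OF psd])
  have Vlim: "(\<lambda>k. V k x) \<longlonglongrightarrow> K x" for x
  proof (rule coercive_tendsto)
    show "(\<lambda>k. P k (A x + B (K x))) \<longlonglongrightarrow> L (A x + B (K x))" by (rule L(2))
    fix k
    let ?d = "V k x - K x"
    have 1: "?d \<bullet> R (V k x) + B ?d \<bullet> P k (B (V k x)) = - (B ?d \<bullet> P k (A x))"
      "?d \<bullet> R (K x) + B ?d \<bullet> L (B (K x)) = - (B ?d \<bullet> L (A x))"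
      using V[of k] K by (auto simp: dt_opt_gain_def)
    have 2: "0 \<le> B ?d \<bullet> P k (B ?d)" by (rule psd_nonneg[OF psd])
    have 3: "B ?d \<bullet> P k (B ?d) = B ?d \<bullet> P k (B (V k x)) - B ?d \<bullet> P k (B (K x))"
      by (simp add: linear_diff[OF B] linear_diff[OF psd_linear[OF psd]] inner_diff_right)
    have 4: "?d \<bullet> R ?d = ?d \<bullet> R (V k x) - ?d \<bullet> R (K x)"
      by (simp add: linear_diff[OF pos_def_linear[OF R]] inner_diff_right)
    have 5: "B ?d \<bullet> (P k (A x + B (K x)) - L (A x + B (K x))) =
      B ?d \<bullet> P k (A x) + B ?d \<bullet> P k (B (K x)) - (B ?d \<bullet> L (A x) + B ?d \<bullet> L (B (K x)))"
      by (simp only: linear_add[OF psd_linear[OF psd]] linear_add[OF psd_linear[OF L(1)]]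
          inner_add_right inner_diff_right)
    show "?d \<bullet> R ?d \<le> - (B ?d \<bullet> (P k (A x + B (K x)) - L (A x + B (K x))))"
      unfolding 4 5 using 1 2 3 by linarith
  qed
  \<comment> \<open>With only pointwise convergence of the operators, \<open>P k\<close> should not
    act on the moving vectors \<open>B (V k x)\<close>. The gain condition removes such terms,
    leaving \<open>P k\<close> applied to the fixed vector \<open>A x\<close>.\<close>
  have alt: "cost x (G x) + (A x + B (G x)) \<bullet> X (A x + B (G x)) =
      x \<bullet> Q x + A x \<bullet> X (A x) + B (G x) \<bullet> X (A x)"
    if "psd X" "dt_opt_gain X G" for X G x
  proof -
    have "G x \<bullet> R (G x) + B (G x) \<bullet> X (B (G x)) = - (B (G x) \<bullet> X (A x))"
      using that(2) by (simp add: dt_opt_gain_def)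
    then show ?thesis
      using self_adjoint_commute[OF psd_self_adjoint[OF that(1)], of "A x" "B (G x)"]
      by (simp add: cost_def linear_add[OF psd_linear[OF that(1)]] inner_add_left inner_add_right)
  qed
  have ric: "x \<bullet> L x = cost x (K x) + (A x + B (K x)) \<bullet> L (A x + B (K x))" for x
  proof (rule LIMSEQ_unique)
    show "(\<lambda>k. x \<bullet> P (Suc k) x) \<longlonglongrightarrow> x \<bullet> L x"
      by (intro tendsto_intros LIMSEQ_Suc L)
    have "(\<lambda>k. x \<bullet> Q x + A x \<bullet> P k (A x) + B (V k x) \<bullet> P k (A x))
        \<longlonglongrightarrow> x \<bullet> Q x + A x \<bullet> L (A x) + B (K x) \<bullet> L (A x)"
      by (intro tendsto_intros L bounded_linear.tendsto[OF linear_conv_bounded_linear[THEN iffD1, OF B]] Vlim)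
    moreover have "x \<bullet> P (Suc k) x = x \<bullet> Q x + A x \<bullet> P k (A x) + B (V k x) \<bullet> P k (A x)" for k
      unfolding P_Suc bellman(2)[OF psd] V_def[symmetric] by (rule alt[OF psd V])
    ultimately show "(\<lambda>k. x \<bullet> P (Suc k) x) \<longlonglongrightarrow> cost x (K x) + (A x + B (K x)) \<bullet> L (A x + B (K x))"
      by (simp only: alt[OF L(1) K])
  qed
  have "pos_def L"
    unfolding pos_def_def
  proof (intro conjI allI impI)
    fix x :: 'a assume "x \<noteq> 0"
    then have "0 < x \<bullet> Q x" by (rule pos_def_pos[OF Q])
    also have "\<dots> \<le> x \<bullet> L x"
      using ric[of x] cost_ge_state[of x "K x"] psd_nonneg[OF L(1), of "A x + B (K x)"] by linarith
    finally show "0 < x \<bullet> L x" .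
  qed (rule psd_self_adjoint[OF L(1)])
  then show ?thesis using that ric K unfolding dt_riccati_def by blast
qed

end

section \<open>Initial supersolution from a stabilizing feedback\<close>

text \<open>Solvability comes from linear algebra instead of summing the series over the powers of
  \<open>F\<close>, so pointwise decay suffices and no decay rate has to be extracted. The solution
  is symmetrized afterwards; its form decreases along orbits to the limit 0, hence is
  nonnegative.\<close>

lemma stein_equation:
  fixes F :: "complex^'n::finite \<Rightarrow> complex^'n"
  assumes F: "linear F" and stable: "\<And>x. (\<lambda>t. (F ^^ t) x) \<longlonglongrightarrow> 0" and W: "psd W"
  obtains P where "psd P" "\<And>x. x \<bullet> P x = x \<bullet> W x + F x \<bullet> P (F x)"
proof -
  note linF = linear_add[OF F] linear_scale[OF F] linear_add[OF adjoint_linear[OF F]]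
    linear_scale[OF adjoint_linear[OF F]]
  define T where "T X = (\<lambda>x. X x - adjoint F (X (F x)))" for X
  obtain X where X: "linear X" "T X = W"
  proof (rule linear_operator_equation_solvable[of T])
    show "linear (T X)" if "linear X" for X
      unfolding T_def
      by (rule linearI) (simp_all add: linear_add[OF that] linear_scale[OF that] linF algebra_simps)
    show "T (\<lambda>x. X x + Y x) x = T X x + T Y x" for X Y x
      by (simp add: T_def linF)
    show "T (\<lambda>x. c *\<^sub>R X x) x = c *\<^sub>R T X x" for c X x
      by (simp add: T_def linF algebra_simps)
    show "X = (\<lambda>x. 0)" if X: "linear X" "\<And>x. T X x = 0" for X
    proof
      fix x
      have step: "y \<bullet> X x = F y \<bullet> X (F x)" for x y
        using X(2)[of x] adjoint_works[OF F, of y "X (F x)"] by (simp add: T_def)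
      have "y \<bullet> X x = 0" for y
      proof (rule LIMSEQ_unique)
        have "(F ^^ t) y \<bullet> X ((F ^^ t) x) = y \<bullet> X x" for t
          by (induction t) (simp_all flip: step)
        then show "(\<lambda>t. (F ^^ t) y \<bullet> X ((F ^^ t) x)) \<longlonglongrightarrow> y \<bullet> X x" by simp
        show "(\<lambda>t. (F ^^ t) y \<bullet> X ((F ^^ t) x)) \<longlonglongrightarrow> 0"
          by (intro tendsto_quadratic_zero X stable)
      qed
      then show "X x = 0" by (metis inner_eq_zero_iff)
    qed
  qed (use psd_linear[OF W] in auto)
  obtain P where P: "self_adjoint P" "\<And>x. x \<bullet> P x = x \<bullet> X x"
    using symmetric_part[OF X(1)] by blast
  have eq: "x \<bullet> P x = x \<bullet> W x + F x \<bullet> P (F x)" for x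
    unfolding P(2) X(2)[symmetric] by (simp add: T_def inner_diff_right adjoint_works[OF F])
  have "0 \<le> x \<bullet> P x" for x
  proof (rule LIMSEQ_le_const2)
    show "(\<lambda>t. (F ^^ t) x \<bullet> P ((F ^^ t) x)) \<longlonglongrightarrow> 0"
      by (intro tendsto_quadratic_zero stable self_adjoint_linear P)
    have "(F ^^ t) x \<bullet> P ((F ^^ t) x) \<le> x \<bullet> P x" for t
    proof (induction t)
      case (Suc t)
      then show ?case using eq[of "(F ^^ t) x"] psd_nonneg[OF W, of "(F ^^ t) x"] by simp
    qed simp
    then show "\<exists>N. \<forall>t\<ge>N. (F ^^ t) x \<bullet> P ((F ^^ t) x) \<le> x \<bullet> P x" by blast
  qed
  then have "psd P" by (simp add: psd_def P(1))
  then show ?thesis using eq by (rule that)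
qed

text \<open>The cost operator of the feedback \<open>K0\<close> is a supersolution, because
  \<open>K0 x\<close> is one of the inputs over which the Bellman operator minimizes.\<close>

lemma dt_riccati_exists_of_stabilizing:
  fixes A :: "complex^'n::finite \<Rightarrow> complex^'n" and B :: "complex^'m::finite \<Rightarrow> complex^'n"
  assumes "lqr A B Q R" and K0: "linear K0"
    and stable: "\<And>x. (\<lambda>t. ((\<lambda>x. A x + B (K0 x)) ^^ t) x) \<longlonglongrightarrow> 0"
  obtains P K where "pos_def P" "lqr.dt_riccati A B Q R P K"
proof -
  interpret lqr A B Q R by fact
  have F: "linear (\<lambda>x. A x + B (K0 x))"
    using linear_compose_add[OF A linear_compose[OF K0 B]] by (simp add: o_def)
  have W: "psd (\<lambda>x. Q x + adjoint K0 (R (K0 x)))"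
    by (intro psd_add psd_congruence(1)[OF pos_def_psd[OF R] K0] pos_def_psd Q)
  obtain P where P: "psd P" "\<And>x. x \<bullet> P x = x \<bullet> (Q x + adjoint K0 (R (K0 x))) +
      (A x + B (K0 x)) \<bullet> P (A x + B (K0 x))"
    using stein_equation[OF F stable W] by blast
  show ?thesis
  proof (rule dt_riccati_exists[OF P(1)])
    fix x
    have "x \<bullet> P x = cost x (K0 x) + (A x + B (K0 x)) \<bullet> P (A x + B (K0 x))"
      by (subst P(2)) (simp add: cost_def inner_add_right psd_congruence(2)[OF pos_def_psd[OF R] K0])
    then show "x \<bullet> bellman P x \<le> x \<bullet> P x" using bellman_le[OF P(1)] by simp
  qed (use that in blast)
qed

section \<open>Linear differential equations and integral solutions\<close>

text \<open>The exponential series of \<open>F\<close>, handled through scalar power series: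
  \<open>g y t\<close> is the pairing of the solution with a test vector \<open>y\<close>, so real
  termwise differentiation applies.\<close>

lemma linear_ode_exists:
  fixes F :: "'a::euclidean_space \<Rightarrow> 'a"
  assumes F: "linear F"
  obtains \<phi> where "\<phi> 0 = x0" "\<And>t. (\<phi> has_vector_derivative F (\<phi> t)) (at t)"
proof -
  define c where "c y n = ((F ^^ n) x0 \<bullet> y) / fact n" for y n
  define g where "g y t = (\<Sum>n. c y n * t ^ n)" for y and t :: real
  obtain k where k: "k > 0" "\<And>x. norm (F x) \<le> k * norm x"
    using linear_bounded_pos[OF F] by blast
  have pow: "norm ((F ^^ n) x0) \<le> k ^ n * norm x0" for n
  proof (induction n)
    case (Suc n)
    have "norm ((F ^^ Suc n) x0) \<le> k * norm ((F ^^ n) x0)" using k(2) by simp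
    also have "\<dots> \<le> k * (k ^ n * norm x0)" using Suc k(1) by simp
    finally show ?case by (simp add: algebra_simps)
  qed simp
  have sm: "summable (\<lambda>n. c y n * t ^ n)" for y t
  proof (rule summable_comparison_test')
    show "summable (\<lambda>n. norm x0 * norm y * (inverse (fact n) * (k * \<bar>t\<bar>) ^ n))"
      by (intro summable_mult summable_exp)
    show "norm (c y n * t ^ n) \<le> norm x0 * norm y * (inverse (fact n) * (k * \<bar>t\<bar>) ^ n)" for n
    proof -
      have "\<bar>(F ^^ n) x0 \<bullet> y\<bar> \<le> k ^ n * norm x0 * norm y"
        by (rule order_trans[OF Cauchy_Schwarz_ineq2]) (intro mult_right_mono pow norm_ge_zero)
      then have "\<bar>(F ^^ n) x0 \<bullet> y\<bar> * (\<bar>t\<bar> ^ n * inverse (fact n)) \<le>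
          k ^ n * norm x0 * norm y * (\<bar>t\<bar> ^ n * inverse (fact n))"
        by (rule mult_right_mono) simp
      then show ?thesis
        by (simp add: c_def abs_mult power_abs power_mult_distrib field_simps)
    qed
  qed
  have g_sums: "(\<lambda>n. c y n * t ^ n) sums g y t" for y t
    unfolding g_def by (rule summable_sums[OF sm])
  define \<phi> where "\<phi> t = (\<Sum>b\<in>Basis. g b t *\<^sub>R b)" for t
  \<comment> \<open>Arbitrary test vectors matter: differentiating the coordinate at a basis vector
    \<open>b\<close> leads to the pairing with \<open>adjoint F b\<close>, which need not be a basis
    vector.\<close>
  have inner: "\<phi> t \<bullet> y = g y t" for t y
  proof -
    have "(\<lambda>n. \<Sum>b\<in>Basis. (c b n * t ^ n) * (b \<bullet> y)) sums (\<Sum>b\<in>Basis. g b t * (b \<bullet> y))"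
      by (intro sums_sum sums_mult2 g_sums)
    moreover have "(\<Sum>b\<in>Basis. (c b n * t ^ n) * (b \<bullet> y)) = c y n * t ^ n" for n
    proof -
      have "(F ^^ n) x0 \<bullet> y = (\<Sum>b\<in>Basis. ((F ^^ n) x0 \<bullet> b) * (b \<bullet> y))"
        by (subst euclidean_inner) (simp add: inner_commute)
      then show ?thesis by (simp add: c_def sum_divide_distrib sum_distrib_right sum_distrib_left algebra_simps)
    qed
    ultimately have "g y t = (\<Sum>b\<in>Basis. g b t * (b \<bullet> y))"
      using g_sums[of y t] sums_unique2 by fastforce
    then show ?thesis by (simp add: \<phi>_def inner_sum_left)
  qed
  have diffs: "diffs (c y) = c (adjoint F y)" for y
  proof
    fix n
    have "diffs (c y) n = (F ((F ^^ n) x0) \<bullet> y) / fact n"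
      by (simp add: diffs_def c_def del: of_nat_Suc)
    then show "diffs (c y) n = c (adjoint F y) n"
      by (simp add: c_def adjoint_works[OF F])
  qed
  have "(g y has_vector_derivative g (adjoint F y) t) (at t)" for y t
    using termdiffs_strong_converges_everywhere[of "c y" t, OF sm]
    unfolding g_def[abs_def] diffs
    by (simp add: has_real_derivative_iff_has_vector_derivative)
  then have "(\<phi> has_vector_derivative (\<Sum>b\<in>Basis. g (adjoint F b) t *\<^sub>R b)) (at t)" for t
    unfolding \<phi>_def[abs_def]
    by (intro has_vector_derivative_sum) (auto simp: has_real_derivative_iff_has_vector_derivative intro!: derivative_eq_intros)
  moreover have "(\<Sum>b\<in>Basis. g (adjoint F b) t *\<^sub>R b) = F (\<phi> t)" for t
    by (simp flip: inner add: adjoint_works[OF F] euclidean_representation)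
  ultimately have "(\<phi> has_vector_derivative F (\<phi> t)) (at t)" for t by simp
  moreover have "\<phi> 0 = x0"
  proof -
    have "g y 0 = x0 \<bullet> y" for y
    proof -
      have "(\<lambda>n. c y n * 0 ^ n) sums (c y 0 * 0 ^ 0)"
        using powser_sums_zero[of "c y"] by simp
      then show ?thesis using g_sums[of y 0] sums_unique2 by (fastforce simp: c_def)
    qed
    then show ?thesis by (simp add: \<phi>_def euclidean_representation)
  qed
  ultimately show ?thesis using that by blast
qed

section \<open>Integral solutions and the energy identity\<close>

text \<open>Encodes a Caratheodory solution by a gauge integral, with \<open>w\<close> as the
  velocity. The case \<open>t = 0\<close> contains the initial condition.\<close>

definition primitive :: "(real \<Rightarrow> 'a::euclidean_space) \<Rightarrow> 'a \<Rightarrow> (real \<Rightarrow> 'a) \<Rightarrow> bool" where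
  "primitive x x0 w \<longleftrightarrow> (\<forall>t\<ge>0. (w has_integral (x t - x0)) {0..t})"

lemma primitive_0: "primitive x x0 w \<Longrightarrow> x 0 = x0"
  unfolding primitive_def
  by (metis atLeastAtMost_singleton eq_iff_diff_eq_0 has_integral_is_0 has_integral_refl(1)
      has_integral_unique order_refl box_real(2))

lemma primitive_diff:
  assumes "primitive x x0 w" "0 \<le> s" "s \<le> t"
  shows "(w has_integral (x t - x s)) {s..t}"
proof -
  have int: "(w has_integral (x s - x0)) {0..s}" "(w has_integral (x t - x0)) {0..t}"
    using assms by (auto simp: primitive_def)
  then have "w integrable_on {0..t}" by blast
  then have "w integrable_on {s..t}"
    by (rule integrable_on_subinterval) (use assms in auto)
  moreover have "integral {s..t} w = x t - x s"
    using Henstock_Kurzweil_Integration.integral_combine[OF assms(2,3) \<open>w integrable_on {0..t}\<close>] int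
    by (auto simp: integral_unique algebra_simps)
  ultimately show ?thesis by (metis integrable_integral)
qed

lemma primitive_continuous:
  assumes "primitive x x0 w"
  shows "continuous_on {0..T} x"
proof (cases "0 \<le> T")
  case True
  then have "w integrable_on {0..T}" using assms by (auto simp: primitive_def)
  then have "continuous_on {0..T} (\<lambda>t. x0 + integral {0..t} w)"
    by (intro continuous_intros indefinite_integral_continuous_1)
  moreover have "x0 + integral {0..t} w = x t" if "t \<in> {0..T}" for t
    using assms that by (auto simp: primitive_def integral_unique)
  ultimately show ?thesis by (metis (no_types, lifting) continuous_on_cong)
qed simp

lemma primitive_of_derivative:
  assumes "\<And>t. t \<ge> 0 \<Longrightarrow> (x has_vector_derivative w t) (at t)"
  shows "primitive x (x 0) w"
  unfolding primitive_def
  by (auto intro!: fundamental_theorem_of_calculus has_vector_derivative_at_within assms)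

text \<open>A substitute for the vanishing derivative: cut the interval into equal pieces shorter
  than \<open>\<delta>\<close>. The increments of \<open>G\<close> telescope, so the total change of
  \<open>\<phi>\<close> is at most \<open>\<epsilon>\<close> times a fixed number.\<close>

lemma constant_if_small_increments:
  fixes \<phi> G :: "real \<Rightarrow> real"
  assumes T: "0 \<le> T"
    and small: "\<And>\<epsilon>. \<epsilon> > 0 \<Longrightarrow> \<exists>\<delta>>0. \<forall>s t. 0 \<le> s \<and> s \<le> t \<and> t \<le> T \<and> t - s < \<delta> \<longrightarrow>
      \<bar>\<phi> t - \<phi> s\<bar> \<le> \<epsilon> * (G t - G s)"
  shows "\<phi> T = \<phi> 0"
proof (rule ccontr)
  assume "\<phi> T \<noteq> \<phi> 0"
  define d where "d = \<bar>\<phi> T - \<phi> 0\<bar>"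
  \<comment> \<open>The added 1 makes \<open>m\<close> positive, and \<open>\<epsilon>\<close> below
    is chosen so that the telescoped bound is at most \<open>d / 2\<close>, contradicting
    \<open>d > 0\<close>.\<close>
  define m where "m = \<bar>G T - G 0\<bar> + 1"
  define \<epsilon> where "\<epsilon> = d / (2 * m)"
  have "m > 0" by (simp add: m_def add_nonneg_pos)
  have "d > 0" using \<open>\<phi> T \<noteq> \<phi> 0\<close> by (simp add: d_def)
  then have "\<epsilon> > 0" using \<open>m > 0\<close> by (simp add: \<epsilon>_def)
  then obtain \<delta> where \<delta>: "\<delta> > 0"
    "\<And>s t. 0 \<le> s \<Longrightarrow> s \<le> t \<Longrightarrow> t \<le> T \<Longrightarrow> t - s < \<delta> \<Longrightarrow> \<bar>\<phi> t - \<phi> s\<bar> \<le> \<epsilon> * (G t - G s)"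
    using small[OF \<open>\<epsilon> > 0\<close>] by blast
  obtain n :: nat where n: "T / \<delta> < real n" using reals_Archimedean2 by blast
  have "n > 0" using n T \<delta>(1) by (metis divide_nonneg_pos gr0I not_less of_nat_0)
  then have h: "T / n < \<delta>" "0 \<le> T / n" using n \<delta>(1) T by (simp_all add: field_simps)
  have "\<bar>\<phi> (k * (T / n)) - \<phi> 0\<bar> \<le> \<epsilon> * (G (k * (T / n)) - G 0)" if "k \<le> n" for k
    using that
  proof (induction k)
    case (Suc k)
    have "Suc k * (T / n) \<le> n * (T / n)"
      using Suc.prems h(2) by (intro mult_right_mono) auto
    then have le: "Suc k * (T / n) \<le> T" using \<open>n > 0\<close> by simp
    have "\<bar>\<phi> (Suc k * (T / n)) - \<phi> (k * (T / n))\<bar> \<le> \<epsilon> * (G (Suc k * (T / n)) - G (k * (T / n)))"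
    proof (rule \<delta>(2)[OF _ _ le])
      show "0 \<le> k * (T / n)" using h(2) by (intro mult_nonneg_nonneg) auto
      show "k * (T / n) \<le> Suc k * (T / n)" using h(2) by (intro mult_right_mono) auto
      show "Suc k * (T / n) - k * (T / n) < \<delta>" using h(1) by (simp add: algebra_simps add_divide_distrib)
    qed
    moreover have "\<bar>\<phi> (k * (T / n)) - \<phi> 0\<bar> \<le> \<epsilon> * (G (k * (T / n)) - G 0)"
      using Suc by simp
    ultimately show ?case by (simp only: right_diff_distrib)
  qed simp
  from this[of n] have "d \<le> \<epsilon> * (G T - G 0)" using \<open>n > 0\<close> by (simp add: d_def)
  also have "\<dots> \<le> \<epsilon> * m" using \<open>\<epsilon> > 0\<close> by (intro mult_left_mono) (auto simp: m_def)
  also have "\<dots> = d / 2" using \<open>m > 0\<close> by (simp add: \<epsilon>_def)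
  finally show False using \<open>d > 0\<close> by simp
qed

lemma absolutely_integrable_inner_continuous:
  fixes y w :: "real \<Rightarrow> 'a::euclidean_space"
  assumes "continuous_on {a..b} y" "w absolutely_integrable_on {a..b}"
  shows "(\<lambda>s. y s \<bullet> w s) absolutely_integrable_on {a..b}"
proof (rule absolutely_integrable_bounded_measurable_product[where h = "(\<bullet>)" and f = y, OF _ _ _ _ assms(2)])
  show "bilinear ((\<bullet>) :: 'a \<Rightarrow> 'a \<Rightarrow> real)"
    by (simp add: bilinear_conv_bounded_bilinear bounded_bilinear_inner)
  show "y \<in> borel_measurable (lebesgue_on {a..b})"
    by (intro continuous_imp_measurable_on_sets_lebesgue assms(1)) simp
  show "bounded (y ` {a..b})"
    by (intro compact_imp_bounded compact_continuous_image assms(1)) simp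
qed simp

text \<open>Since \<open>w\<close> is merely integrable, \<open>x\<close> need not be differentiable.  Instead, by uniform continuity of
  \<open>x\<close> the increments of the difference of both sides are arbitrarily small multiples of those of
  \<open>\<integral>|w|\<close>.\<close>

lemma primitive_quadratic:
  fixes x w :: "real \<Rightarrow> 'a::euclidean_space"
  assumes prim: "primitive x x0 w" and w: "w absolutely_integrable_on {0..T}"
    and P: "self_adjoint P" and T: "0 \<le> T"
  shows "((\<lambda>s. 2 * (P (x s) \<bullet> w s)) has_integral (x T \<bullet> P (x T) - x0 \<bullet> P x0)) {0..T}"
proof -
  note lin = self_adjoint_linear[OF P]
  have cx: "continuous_on {0..T} x" using prim by (rule primitive_continuous)
  have cP: "continuous_on {0..T} (\<lambda>s. P (x s))"
    by (intro linear_continuous_on_compose[OF cx lin])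
  define h where "h s = 2 * (P (x s) \<bullet> w s)" for s
  have h: "h absolutely_integrable_on {0..T}"
    using absolutely_integrable_inner_continuous[OF continuous_on_scaleR[OF continuous_on_const cP] w, of 2]
    by (simp add: h_def[abs_def])
  define G where "G t = integral {0..t} (\<lambda>s. norm (w s))" for t
  define \<phi> where "\<phi> t = x t \<bullet> P (x t) - integral {0..t} h" for t
  obtain C where C: "C > 0" "\<And>x. norm (P x) \<le> C * norm x"
    using linear_bounded_pos[OF lin] by blast
  have hT: "h integrable_on {0..T}" and wT: "(\<lambda>s. norm (w s)) integrable_on {0..T}"
    using h w by (auto simp: absolutely_integrable_on_def)
  have "\<phi> T = \<phi> 0"
  proof (rule constant_if_small_increments[OF T])
    fix \<epsilon> :: real assume "\<epsilon> > 0"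
    define \<eta> where "\<eta> = \<epsilon> / (2 * C)"
    have "\<eta> > 0" using \<open>\<epsilon> > 0\<close> C by (simp add: \<eta>_def)
    have "uniformly_continuous_on {0..T} x"
      by (rule compact_uniformly_continuous[OF cx]) simp
    then obtain \<delta> where \<delta>: "\<delta> > 0"
      "\<And>s t. s \<in> {0..T} \<Longrightarrow> t \<in> {0..T} \<Longrightarrow> dist t s < \<delta> \<Longrightarrow> dist (x t) (x s) < \<eta>"
      using \<open>\<eta> > 0\<close> unfolding uniformly_continuous_on_def by metis
    show "\<exists>\<delta>>0. \<forall>s t. 0 \<le> s \<and> s \<le> t \<and> t \<le> T \<and> t - s < \<delta> \<longrightarrow> \<bar>\<phi> t - \<phi> s\<bar> \<le> \<epsilon> * (G t - G s)"
    proof (intro exI[of _ \<delta>] conjI allI impI \<delta>(1))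
      fix s t assume st: "0 \<le> s \<and> s \<le> t \<and> t \<le> T \<and> t - s < \<delta>"
      have sub: "h integrable_on {0..t}" "h integrable_on {s..t}"
        "(\<lambda>s. norm (w s)) integrable_on {0..t}" "(\<lambda>s. norm (w s)) integrable_on {s..t}"
        by (rule integrable_on_subinterval[OF hT] integrable_on_subinterval[OF wT], use st in force)+
      have H: "integral {0..t} h - integral {0..s} h = integral {s..t} h"
        and G: "G t - G s = integral {s..t} (\<lambda>s. norm (w s))"
        using Henstock_Kurzweil_Integration.integral_combine[of 0 s t h]
          Henstock_Kurzweil_Integration.integral_combine[of 0 s t "\<lambda>s. norm (w s)"] st sub
        by (auto simp: G_def)
      \<comment> \<open>Self-adjointness gives \<open>x t \<bullet> P (x t) - x s \<bullet> P (x s)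
        = P (x t + x s) \<bullet> (x t - x s)\<close>, which is an integral against
        \<open>w\<close>. Subtracting \<open>h\<close> leaves the integrand
        \<open>z \<tau> \<bullet> w \<tau>\<close>, where \<open>z\<close> is small by uniform
        continuity of \<open>x\<close>.\<close>
      define z where "z \<tau> = P (x t + x s - 2 *\<^sub>R x \<tau>)" for \<tau>
      have "((\<lambda>\<tau>. P (x t + x s) \<bullet> w \<tau>) has_integral (P (x t + x s) \<bullet> (x t - x s))) {s..t}"
        using has_integral_linear[OF primitive_diff[OF prim] bounded_linear_inner_right] st
        by (simp add: o_def)
      then have "((\<lambda>\<tau>. P (x t + x s) \<bullet> w \<tau> - h \<tau>) has_integral
          (P (x t + x s) \<bullet> (x t - x s) - integral {s..t} h)) {s..t}"
        by (intro has_integral_diff integrable_integral sub)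
      moreover have "P (x t + x s) \<bullet> (x t - x s) - integral {s..t} h = \<phi> t - \<phi> s"
        using self_adjoint_commute[OF P, of "x s" "x t"] unfolding H[symmetric] \<phi>_def
        by (simp add: linear_add[OF lin] inner_add_left inner_add_right inner_diff_left inner_diff_right
            inner_commute)
      moreover have "P (x t + x s) \<bullet> w \<tau> - h \<tau> = z \<tau> \<bullet> w \<tau>" for \<tau>
        by (simp add: z_def h_def linear_add[OF lin] linear_diff[OF lin] linear_scale[OF lin]
            inner_diff_left)
      ultimately have int: "((\<lambda>\<tau>. z \<tau> \<bullet> w \<tau>) has_integral (\<phi> t - \<phi> s)) {s..t}" by simp
      have "norm (z \<tau> \<bullet> w \<tau>) \<le> \<epsilon> * norm (w \<tau>)" if "\<tau> \<in> {s..t}" for \<tau>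
      proof -
        have "dist (x t) (x \<tau>) < \<eta>" "dist (x s) (x \<tau>) < \<eta>"
          using that st by (auto intro!: \<delta>(2) simp: dist_real_def)
        moreover have "norm (x t + x s - 2 *\<^sub>R x \<tau>) \<le> dist (x t) (x \<tau>) + dist (x s) (x \<tau>)"
          using norm_triangle_ineq[of "x t - x \<tau>" "x s - x \<tau>"]
          by (simp add: dist_norm scaleR_2 algebra_simps)
        ultimately have "norm (x t + x s - 2 *\<^sub>R x \<tau>) \<le> 2 * \<eta>" by linarith
        then have "C * norm (x t + x s - 2 *\<^sub>R x \<tau>) \<le> C * (2 * \<eta>)"
          using C(1) by (intro mult_left_mono) auto
        also have "\<dots> = \<epsilon>" using C(1) by (simp add: \<eta>_def)
        finally have "norm (z \<tau>) \<le> \<epsilon>" using C(2)[of "x t + x s - 2 *\<^sub>R x \<tau>"] by (simp add: z_def)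
        then have "norm (z \<tau>) * norm (w \<tau>) \<le> \<epsilon> * norm (w \<tau>)" by (intro mult_right_mono) auto
        then show ?thesis using Cauchy_Schwarz_ineq2[of "z \<tau>" "w \<tau>"] by simp
      qed
      then have "norm (integral {s..t} (\<lambda>\<tau>. z \<tau> \<bullet> w \<tau>)) \<le> integral {s..t} (\<lambda>\<tau>. \<epsilon> * norm (w \<tau>))"
        using int sub(4) by (intro integral_norm_bound_integral integrable_on_mult_right) auto
      then show "\<bar>\<phi> t - \<phi> s\<bar> \<le> \<epsilon> * (G t - G s)"
        using int by (simp add: G integral_unique)
    qed
  qed
  then have "integral {0..T} h = x T \<bullet> P (x T) - x0 \<bullet> P x0"
    by (simp add: \<phi>_def primitive_0[OF prim])
  then show ?thesis using hT unfolding h_def[abs_def] by (metis integrable_integral)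
qed

section \<open>The continuous-time regulator\<close>

definition ct_stable :: "('a::euclidean_space \<Rightarrow> 'a) \<Rightarrow> bool" where
  "ct_stable F \<longleftrightarrow> (\<forall>x0 x. primitive x x0 (\<lambda>s. F (x s)) \<longrightarrow> (x \<longlongrightarrow> 0) at_top)"

lemma ct_flow_quadratic:
  assumes F: "linear F" and x: "primitive x x0 (\<lambda>s. F (x s))" and P: "self_adjoint P" and "0 \<le> t"
  shows "((\<lambda>s. 2 * (P (x s) \<bullet> F (x s))) has_integral (x t \<bullet> P (x t) - x0 \<bullet> P x0)) {0..t}"
  by (intro primitive_quadratic[OF x _ P \<open>0 \<le> t\<close>] absolutely_integrable_continuous_real
      linear_continuous_on_compose[OF primitive_continuous[OF x] F])

text \<open>Only the integral form of the decay of \<open>V\<close> is available, and it already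
  yields a bound proportional to \<open>1 / t\<close>; an exponential rate is avoided.\<close>

lemma ct_stable_lyapunov:
  assumes F: "linear F" and P: "pos_def P" and W: "pos_def W"
    and le: "\<And>x. 2 * (P x \<bullet> F x) + x \<bullet> W x \<le> 0"
  shows "ct_stable F"
  unfolding ct_stable_def
proof (intro allI impI)
  fix x0 x assume x: "primitive x x0 (\<lambda>s. F (x s))"
  define V where "V t = x t \<bullet> P (x t)" for t
  have V0: "0 \<le> V t" for t by (simp add: V_def pos_def_nonneg[OF P])
  obtain c where c: "c > 0" "\<And>x. c * (norm x)\<^sup>2 \<le> x \<bullet> W x" using pos_def_coercive[OF W] by blast
  obtain C where C: "C > 0" "\<And>x. norm (P x) \<le> C * norm x"
    using linear_bounded_pos[OF pos_def_linear[OF P]] by blast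
  \<comment> \<open>\<open>W\<close> dominates \<open>c\<close> times the squared norm and
    \<open>P\<close> is dominated by \<open>C\<close> times it, so \<open>k\<close> times the form
    of \<open>P\<close> stays below that of \<open>W\<close>.\<close>
  define k where "k = c / C"
  have k: "k > 0" using c C by (simp add: k_def)
  have kV: "k * (y \<bullet> P y) \<le> y \<bullet> W y" for y
  proof -
    have "y \<bullet> P y \<le> norm y * norm (P y)" by (rule norm_cauchy_schwarz)
    also have "\<dots> \<le> norm y * (C * norm y)" by (intro mult_left_mono C) auto
    finally have "k * (y \<bullet> P y) \<le> k * (C * (norm y)\<^sup>2)"
      using k by (intro mult_left_mono) (auto simp: power2_eq_square algebra_simps)
    also have "\<dots> = c * (norm y)\<^sup>2" using C by (simp add: k_def)
    finally show ?thesis using c(2)[of y] by linarith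
  qed
  have incr: "((\<lambda>s. 2 * (P (x s) \<bullet> F (x s))) has_integral (V t - V s)) {s..t}" if "0 \<le> s" "s \<le> t" for s t
  proof -
    have prim: "primitive V (x0 \<bullet> P x0) (\<lambda>s. 2 * (P (x s) \<bullet> F (x s)))"
      unfolding primitive_def V_def
      by (intro allI impI ct_flow_quadratic[OF F x pos_def_self_adjoint[OF P]])
    show ?thesis by (rule primitive_diff[OF prim that])
  qed
  have dec: "V t \<le> V s" if "0 \<le> s" "s \<le> t" for s t
  proof -
    have "V t - V s \<le> 0"
    proof (rule has_integral_le[OF incr[OF that] has_integral_0])
      fix r show "2 * (P (x r) \<bullet> F (x r)) \<le> 0"
        using le[of "x r"] pos_def_nonneg[OF W, of "x r"] by linarith
    qed
    then show ?thesis by simp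
  qed
  \<comment> \<open>As \<open>V\<close> is nonincreasing, \<open>k t V(t)\<close> is at most the dissipated energy \<open>V(0) - V(t)\<close>.\<close>
  have bound: "V t \<le> (V 0 / k) / t" if "t > 0" for t
  proof -
    have "V t - V 0 \<le> - (k * V t) * t"
    proof (rule has_integral_le[OF incr])
      show "((\<lambda>r. - (k * V t)) has_integral - (k * V t) * t) {0..t}"
        using has_integral_const_real[of "- (k * V t)" 0 t] that by (simp add: mult.commute)
      fix r assume r: "r \<in> {0..t}"
      have "k * V t \<le> k * V r" using k dec[of r t] r by (intro mult_left_mono) auto
      also have "\<dots> \<le> x r \<bullet> W (x r)" unfolding V_def by (rule kV)
      finally show "2 * (P (x r) \<bullet> F (x r)) \<le> - (k * V t)" using le[of "x r"] by linarith
    qed (use that in auto)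
    then have "V t * (k * t) \<le> V 0" using V0[of t] by (simp add: algebra_simps)
    then show ?thesis using k that by (simp add: field_simps)
  qed
  have "((\<lambda>t. (V 0 / k) / t) \<longlongrightarrow> 0) at_top"
    by (intro tendsto_divide_0[OF tendsto_const] filterlim_at_top_imp_at_infinity filterlim_ident)
  moreover have "\<forall>\<^sub>F t in at_top. V t \<le> (V 0 / k) / t"
    using eventually_gt_at_top[of 0] by eventually_elim (rule bound)
  ultimately have "(V \<longlongrightarrow> 0) at_top"
    by (intro tendsto_sandwich[OF _ _ tendsto_const, of 0 V at_top]) (auto simp: V0)
  then show "(x \<longlongrightarrow> 0) at_top" unfolding V_def[abs_def] by (rule tendsto_zero_pos_def[OF P])
qed

text \<open>The form cannot increase along the flow and tends to 0, so it starts nonnegative. This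
  serves both for positivity of Lyapunov solutions and for monotonicity of policy iteration.\<close>

lemma ct_stable_quadratic_nonneg:
  fixes F :: "'a::euclidean_space \<Rightarrow> 'a"
  assumes F: "linear F" and stable: "ct_stable F" and P: "self_adjoint P"
    and le: "\<And>x. P x \<bullet> F x \<le> 0"
  shows "0 \<le> x \<bullet> P x"
proof -
  obtain \<phi> where \<phi>: "\<phi> 0 = x" "\<And>t. (\<phi> has_vector_derivative F (\<phi> t)) (at t)"
    using linear_ode_exists[OF F] by blast
  have prim: "primitive \<phi> x (\<lambda>s. F (\<phi> s))"
    using primitive_of_derivative[of \<phi> "\<lambda>s. F (\<phi> s)"] \<phi> by auto
  then have "(\<phi> \<longlongrightarrow> 0) at_top" using stable by (simp add: ct_stable_def)
  then have "((\<lambda>t. \<phi> t \<bullet> P (\<phi> t)) \<longlongrightarrow> 0) at_top"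
    by (intro tendsto_quadratic_zero self_adjoint_linear P)
  moreover have "\<phi> t \<bullet> P (\<phi> t) \<le> x \<bullet> P x" if "0 \<le> t" for t
  proof -
    have "\<phi> t \<bullet> P (\<phi> t) - x \<bullet> P x \<le> 0"
      by (rule has_integral_le[OF ct_flow_quadratic[OF F prim P that] has_integral_0]) (use le in simp)
    then show ?thesis by simp
  qed
  ultimately show ?thesis
    by (intro tendsto_upperbound[of _ 0 at_top]) (auto intro: eventually_mono[OF eventually_ge_at_top[of 0]])
qed

lemma lyapunov_equation:
  fixes F :: "complex^'n::finite \<Rightarrow> complex^'n"
  assumes F: "linear F" and stable: "ct_stable F" and W: "psd W"
  obtains P where "psd P" "\<And>x. 2 * (P x \<bullet> F x) + x \<bullet> W x = 0"
proof -
  note linF = linear_add[OF F] linear_scale[OF F] linear_add[OF adjoint_linear[OF F]]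
    linear_scale[OF adjoint_linear[OF F]]
  note linW = linear_add[OF psd_linear[OF W]] linear_scale[OF psd_linear[OF W]]
  define T where "T X = (\<lambda>x. adjoint F (X x) + X (F x))" for X
  obtain X where X: "linear X" "T X = (\<lambda>x. - W x)"
  proof (rule linear_operator_equation_solvable[of T])
    show "linear (T X)" if "linear X" for X
      unfolding T_def
      by (rule linearI) (simp_all add: linear_add[OF that] linear_scale[OF that] linF algebra_simps)
    show "T (\<lambda>x. X x + Y x) x = T X x + T Y x" for X Y x
      by (simp add: T_def linF)
    show "T (\<lambda>x. c *\<^sub>R X x) x = c *\<^sub>R T X x" for c X x
      by (simp add: T_def linF algebra_simps)
    show "linear (\<lambda>x. - W x)"
      by (rule linearI) (simp_all add: linW)
    show "X = (\<lambda>x. 0)" if X: "linear X" "\<And>x. T X x = 0" for X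
    proof
      fix x
      have step: "F y \<bullet> X x + y \<bullet> X (F x) = 0" for x y
        using arg_cong[OF X(2)[of x], of "inner y"]
        by (simp add: T_def inner_add_right adjoint_works[OF F])
      have "y \<bullet> X x = 0" for y
      proof -
        obtain \<phi> where \<phi>: "\<phi> 0 = x" "\<And>t. (\<phi> has_vector_derivative F (\<phi> t)) (at t)"
          using linear_ode_exists[OF F] by blast
        obtain \<psi> where \<psi>: "\<psi> 0 = y" "\<And>t. (\<psi> has_vector_derivative F (\<psi> t)) (at t)"
          using linear_ode_exists[OF F] by blast
        have "primitive \<phi> x (\<lambda>s. F (\<phi> s))" "primitive \<psi> y (\<lambda>s. F (\<psi> s))"
          using primitive_of_derivative[of \<phi> "\<lambda>s. F (\<phi> s)"] \<phi>
            primitive_of_derivative[of \<psi> "\<lambda>s. F (\<psi> s)"] \<psi> by auto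
        then have "(\<phi> \<longlongrightarrow> 0) at_top" "(\<psi> \<longlongrightarrow> 0) at_top"
          using stable by (auto simp: ct_stable_def)
        then have lim: "((\<lambda>t. \<psi> t \<bullet> X (\<phi> t)) \<longlongrightarrow> 0) at_top"
          by (intro tendsto_quadratic_zero X)
        have "((\<lambda>t. \<psi> t \<bullet> X (\<phi> t)) has_real_derivative 0) (at t)" for t
        proof -
          have "((\<lambda>t. X (\<phi> t)) has_vector_derivative X (F (\<phi> t))) (at t)"
            using bounded_linear.has_vector_derivative[OF _ \<phi>(2)] X(1)
            by (simp add: linear_conv_bounded_linear)
          then have "((\<lambda>t. \<psi> t \<bullet> X (\<phi> t)) has_vector_derivative
              (\<psi> t \<bullet> X (F (\<phi> t)) + F (\<psi> t) \<bullet> X (\<phi> t))) (at t)"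
            by (rule bounded_bilinear.has_vector_derivative[OF bounded_bilinear_inner \<psi>(2)])
          then show ?thesis
            using step[of "\<psi> t" "\<phi> t"]
            by (simp add: has_real_derivative_iff_has_vector_derivative add.commute)
        qed
        then have "\<psi> t \<bullet> X (\<phi> t) = \<psi> 0 \<bullet> X (\<phi> 0)" for t
          by (intro DERIV_isconst_all[of "\<lambda>t. \<psi> t \<bullet> X (\<phi> t)"]) blast
        then show ?thesis using lim \<phi>(1) \<psi>(1) by (simp add: tendsto_const_iff)
      qed
      then show "X x = 0" by (metis inner_eq_zero_iff)
    qed
  qed
  obtain P where P: "self_adjoint P" "\<And>x. x \<bullet> P x = x \<bullet> X x"
    using symmetric_part[OF X(1)] by blast
  have eq: "2 * (P x \<bullet> F x) + x \<bullet> W x = 0" for x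
  proof -
    \<comment> \<open>\<open>P\<close> and \<open>X\<close> agree only as quadratic forms, so the
      mixed term is first expressed by values of the form at \<open>x + F x\<close>,
      \<open>x\<close> and \<open>F x\<close>.\<close>
    have "2 * (P x \<bullet> F x) = (x + F x) \<bullet> P (x + F x) - x \<bullet> P x - F x \<bullet> P (F x)"
      by (simp add: self_adjoint_quadratic_add[OF P(1)] inner_commute)
    also have "\<dots> = F x \<bullet> X x + x \<bullet> X (F x)"
      unfolding P(2) by (simp add: linear_add[OF X(1)] inner_add_left inner_add_right)
    also have "\<dots> = x \<bullet> T X x"
      by (simp add: T_def inner_add_right adjoint_works[OF F])
    finally show ?thesis by (simp add: X(2))
  qed
  have "P x \<bullet> F x \<le> 0" for x using eq[of x] psd_nonneg[OF W, of x] by linarith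
  then have "psd P"
    unfolding psd_def using ct_stable_quadratic_nonneg[OF F stable P(1)] P(1) by blast
  then show ?thesis using eq by (rule that)
qed

section \<open>Optimality among locally integrable controls\<close>

context lqr
begin

definition ct_opt_gain :: "('a \<Rightarrow> 'a) \<Rightarrow> ('a \<Rightarrow> 'b) \<Rightarrow> bool" where
  "ct_opt_gain P K \<longleftrightarrow> linear K \<and> (\<forall>x u. u \<bullet> R (K x) = - (B u \<bullet> P x))"

text \<open>The stationary Hamilton-Jacobi-Bellman equation for a quadratic value function,
  evaluated at its minimizing input.\<close>

definition ct_riccati :: "('a \<Rightarrow> 'a) \<Rightarrow> ('a \<Rightarrow> 'b) \<Rightarrow> bool" where
  "ct_riccati P K \<longleftrightarrow> ct_opt_gain P K \<and>
     (\<forall>x. 2 * (P x \<bullet> (A x + B (K x))) + cost x (K x) = 0)"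

definition ct_trajectory :: "'a \<Rightarrow> (real \<Rightarrow> 'a) \<Rightarrow> (real \<Rightarrow> 'b) \<Rightarrow> bool" where
  "ct_trajectory x0 x u \<longleftrightarrow> (\<forall>t\<ge>0. u absolutely_integrable_on {0..t}) \<and>
     primitive x x0 (\<lambda>s. A (x s) + B (u s))"

lemma ct_complete_square:
  assumes "ct_opt_gain P K"
  shows "2 * (P x \<bullet> (A x + B u)) + cost x u =
    2 * (P x \<bullet> (A x + B (K x))) + cost x (K x) + (u - K x) \<bullet> R (u - K x)"
proof -
  have "P x \<bullet> B u = - (u \<bullet> R (K x))" "P x \<bullet> B (K x) = - (K x \<bullet> R (K x))"
    using assms by (auto simp: ct_opt_gain_def inner_commute)
  then show ?thesis
    unfolding cost_def self_adjoint_quadratic_diff[OF pos_def_self_adjoint[OF R]]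
    by (simp add: inner_add_right)
qed

lemma linear_closed_loop: "linear K \<Longrightarrow> linear (\<lambda>x. A x + B (K x))"
  using linear_compose_add[OF A linear_compose[OF _ B]] by (simp add: o_def)

text \<open>With an inequality in place of the Riccati equation the result also covers the
  intermediate policies, for which \<open>P\<close> is only a supersolution.\<close>

lemma ct_closed_loop_stable:
  assumes P: "pos_def P" and K: "linear K"
    and le: "\<And>x. 2 * (P x \<bullet> (A x + B (K x))) + cost x (K x) \<le> 0"
  shows "ct_stable (\<lambda>x. A x + B (K x))"
proof (rule ct_stable_lyapunov[OF linear_closed_loop[OF K] P Q])
  show "2 * (P x \<bullet> (A x + B (K x))) + x \<bullet> Q x \<le> 0" for x
    using le[of x] cost_ge_state[of x "K x"] by linarith
qed

lemma ct_closed_loop_trajectory: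
  assumes K: "linear K"
  obtains x where "ct_trajectory x0 x (\<lambda>t. K (x t))"
proof -
  obtain \<phi> where \<phi>: "\<phi> 0 = x0" "\<And>t. (\<phi> has_vector_derivative A (\<phi> t) + B (K (\<phi> t))) (at t)"
    using linear_ode_exists[OF linear_closed_loop[OF K]] by blast
  have prim: "primitive \<phi> x0 (\<lambda>s. A (\<phi> s) + B (K (\<phi> s)))"
    using primitive_of_derivative[of \<phi> "\<lambda>s. A (\<phi> s) + B (K (\<phi> s))"] \<phi> by auto
  have "(\<lambda>t. K (\<phi> t)) absolutely_integrable_on {0..t}" for t
    by (intro absolutely_integrable_continuous_real
        linear_continuous_on_compose[OF primitive_continuous[OF prim] K])
  then show ?thesis using that prim unfolding ct_trajectory_def by blast
qed

text \<open>The cost and the weighted square are kept in one integrand on purpose. Each may fail to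
  be integrable for a control that is merely integrable, whereas their difference equals
  \<open>- 2 * (P x \<bullet> (A x + B u))\<close> along the trajectory, and this is
  integrable.\<close>

lemma ct_trajectory_energy:
  assumes traj: "ct_trajectory x0 x u" and P: "self_adjoint P" and ric: "ct_riccati P K" and T: "0 \<le> T"
  shows "((\<lambda>s. cost (x s) (u s) - (u s - K (x s)) \<bullet> R (u s - K (x s))) has_integral
    (x0 \<bullet> P x0 - x T \<bullet> P (x T))) {0..T}"
proof -
  let ?w = "\<lambda>s. A (x s) + B (u s)"
  have prim: "primitive x x0 ?w" using traj by (simp add: ct_trajectory_def)
  have "(\<lambda>s. A (x s)) absolutely_integrable_on {0..T}"
    by (intro absolutely_integrable_continuous_real
        linear_continuous_on_compose[OF primitive_continuous[OF prim] A])
  moreover have "(\<lambda>s. B (u s)) absolutely_integrable_on {0..T}"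
    using absolutely_integrable_linear[where f = u and h = B] traj T B
    by (simp add: ct_trajectory_def linear_conv_bounded_linear o_def)
  ultimately have w: "?w absolutely_integrable_on {0..T}" by (rule set_integral_add(1))
  have "cost (x s) (u s) - (u s - K (x s)) \<bullet> R (u s - K (x s)) = - (2 * (P (x s) \<bullet> ?w s))" for s
  proof -
    have "ct_opt_gain P K" "2 * (P (x s) \<bullet> (A (x s) + B (K (x s)))) + cost (x s) (K (x s)) = 0"
      using ric by (simp_all add: ct_riccati_def)
    then show ?thesis using ct_complete_square[of P K "x s" "u s"] by linarith
  qed
  then show ?thesis using has_integral_neg[OF primitive_quadratic[OF prim w P T]] by simp
qed

lemma set_nn_integral_atLeast_le:
  fixes f :: "real \<Rightarrow> real"
  assumes f: "\<And>t. 0 \<le> f t" and int: "\<And>n::nat. (f has_integral I n) {0..n}" and le: "\<And>n. I n \<le> c"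
  shows "(\<integral>\<^sup>+t\<in>{0..}. ennreal (f t) \<partial>lborel) \<le> ennreal c"
proof -
  define g where "g n t = ennreal (f t) * indicator {0..real n} t" for n t
  have g: "integral\<^sup>N lborel (g n) \<le> ennreal c" for n
    unfolding g_def[abs_def]
    using nn_integral_has_integral_lebesgue'[OF f int] le by (simp add: ennreal_leI)
  have "g n \<in> borel_measurable lebesgue" for n
  proof -
    have "(\<lambda>t. ennreal (indicator {0..real n} t *\<^sub>R f t)) \<in> borel_measurable lebesgue"
      using has_integral_implies_lebesgue_measurable[OF int] by measurable
    moreover have "ennreal (indicator {0..real n} t *\<^sub>R f t) = g n t" for t
      by (simp add: g_def split: split_indicator)
    ultimately show ?thesis by (simp add: g_def[abs_def])
  qed
  moreover have "incseq g"
    by (auto simp: incseq_def le_fun_def g_def split: split_indicator)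
  ultimately have "(\<integral>\<^sup>+t. (SUP n. g n t) \<partial>lebesgue) = (SUP n. integral\<^sup>N lebesgue (g n))"
    by (intro nn_integral_monotone_convergence_SUP)
  also have "\<dots> \<le> ennreal c" using g by (simp add: nn_integral_completion SUP_le_iff)
  \<comment> \<open>Gauge integrability only yields Lebesgue measurability, so monotone convergence
    is carried out in the completion and transferred back, where nonnegative integrals
    agree.\<close>
  finally have "(\<integral>\<^sup>+t. (SUP n. g n t) \<partial>lborel) \<le> ennreal c" by (simp add: nn_integral_completion)
  moreover have "(\<integral>\<^sup>+t\<in>{0..}. ennreal (f t) \<partial>lborel) \<le> (\<integral>\<^sup>+t. (SUP n. g n t) \<partial>lborel)"
  proof (rule nn_integral_mono)
    fix t :: real
    obtain n :: nat where "t \<le> n" using real_arch_simple by blast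
    then have "ennreal (f t) * indicator {0..} t = g n t"
      by (simp add: g_def split: split_indicator)
    also have "\<dots> \<le> (SUP n. g n t)" by (rule SUP_upper) simp
    finally show "ennreal (f t) * indicator {0..} t \<le> (SUP n. g n t)" .
  qed
  ultimately show ?thesis by order
qed

lemma has_integral_of_nn_integral_le:
  fixes f :: "real \<Rightarrow> real"
  assumes f: "\<And>t. 0 \<le> f t" and meas: "f \<in> borel_measurable (lebesgue_on S)" and S: "S \<in> sets lebesgue"
    and le: "(\<integral>\<^sup>+t\<in>S. ennreal (f t) \<partial>lborel) \<le> ennreal J" and J: "0 \<le> J"
  obtains c where "(f has_integral c) S" "0 \<le> c" "c \<le> J"
proof -
  define g where "g t = (if t \<in> S then f t else 0)" for t
  have eq: "(\<integral>\<^sup>+t. ennreal (g t) \<partial>lebesgue) = (\<integral>\<^sup>+t\<in>S. ennreal (f t) \<partial>lborel)"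
    unfolding nn_integral_completion by (intro nn_integral_cong) (simp add: g_def)
  then obtain c where c: "(\<integral>\<^sup>+t. ennreal (g t) \<partial>lebesgue) = ennreal c" "0 \<le> c"
    using le by (cases "\<integral>\<^sup>+t\<in>S. ennreal (f t) \<partial>lborel") (auto simp: top_unique)
  have "g \<in> borel_measurable lebesgue"
    using meas unfolding g_def[abs_def] by (simp only: borel_measurable_if[OF S])
  then have "(g has_integral c) UNIV"
    using c by (subst has_integral_iff_nn_integral_lebesgue) (auto simp: g_def f)
  then have "(f has_integral c) S"
    unfolding g_def[abs_def] by (simp only: has_integral_restrict_UNIV)
  moreover have "c \<le> J" using le c J by (simp add: eq[symmetric] ennreal_le_iff)
  ultimately show ?thesis using that c(2) by blast
qed

lemma ct_closed_loop_cost_le: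
  assumes traj: "ct_trajectory x0 x (\<lambda>t. K (x t))" and P: "pos_def P" and ric: "ct_riccati P K"
  shows "(\<integral>\<^sup>+t\<in>{0..}. ennreal (cost (x t) (K (x t))) \<partial>lborel) \<le> ennreal (x0 \<bullet> P x0)"
proof (rule set_nn_integral_atLeast_le)
  show "((\<lambda>t. cost (x t) (K (x t))) has_integral (x0 \<bullet> P x0 - x n \<bullet> P (x n))) {0..n}" for n :: nat
    using ct_trajectory_energy[OF traj pos_def_self_adjoint[OF P] ric, of n] by simp
qed (simp_all add: cost_nonneg pos_def_nonneg P)

lemma ct_cost_measurable:
  assumes "ct_trajectory x0 x u" "0 \<le> T"
  shows "(\<lambda>t. cost (x t) (u t)) \<in> borel_measurable (lebesgue_on {0..T})"
proof -
  have x: "x \<in> borel_measurable (lebesgue_on {0..T})"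
    using assms by (intro continuous_imp_measurable_on_sets_lebesgue primitive_continuous)
      (auto simp: ct_trajectory_def)
  have u: "u \<in> borel_measurable (lebesgue_on {0..T})"
    using assms by (intro absolutely_integrable_imp_borel_measurable) (auto simp: ct_trajectory_def)
  have [measurable]: "Q \<in> borel_measurable borel" "R \<in> borel_measurable borel"
    by (intro borel_measurable_continuous_onI linear_continuous_on
        linear_conv_bounded_linear[THEN iffD1] pos_def_linear Q R)+
  show ?thesis unfolding cost_def using x u by measurable
qed

text \<open>Convergence of \<open>x\<close> is not established for an arbitrary control of finite
  cost. It is enough that \<open>V\<close> cannot stay above a positive level, for the running cost
  would then stay above a positive constant. Evaluating the energy identity at late times with
  \<open>V T < \<epsilon>\<close> bounds the integral of \<open>e\<close> by the excess cost plus
  \<open>\<epsilon>\<close>, and nonnegativity of \<open>e\<close> gives the lower bound.\<close>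

lemma ct_cost_lower_bound:
  assumes traj: "ct_trajectory x0 x u" and P: "pos_def P" and ric: "ct_riccati P K"
  shows "ennreal (x0 \<bullet> P x0) \<le> (\<integral>\<^sup>+t\<in>{0..}. ennreal (cost (x t) (u t)) \<partial>lborel)" (is "_ \<le> ?J")
    and "(\<integral>\<^sup>+t\<in>{0..}. ennreal (cost (x t) (u t)) \<partial>lborel) = ennreal (x0 \<bullet> P x0) \<Longrightarrow>
      AE t in lborel. t \<ge> 0 \<longrightarrow> u t = K (x t)"
proof -
  define V where "V t = x t \<bullet> P (x t)" for t
  define e where "e t = (u t - K (x t)) \<bullet> R (u t - K (x t))" for t
  have e: "0 \<le> e t" for t by (simp add: e_def pos_def_nonneg R)
  have main: "\<exists>T\<ge>T0. T \<ge> 0 \<and> V T < \<epsilon> \<and> (\<exists>d. (e has_integral d) {0..T} \<and> 0 \<le> d \<and> d \<le> J - x0 \<bullet> P x0 + V T)"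
    if J: "?J = ennreal J" "0 \<le> J" and \<epsilon>: "\<epsilon> > 0" for J \<epsilon> T0
  proof -
    have fin: "\<exists>c. ((\<lambda>t. cost (x t) (u t)) has_integral c) {0..T} \<and> 0 \<le> c \<and> c \<le> J" if "0 \<le> T" for T
    proof -
      have "(\<integral>\<^sup>+t\<in>{0..T}. ennreal (cost (x t) (u t)) \<partial>lborel) \<le> ?J"
        by (intro nn_integral_mono) (auto split: split_indicator)
      then show ?thesis
        using has_integral_of_nn_integral_le[OF cost_nonneg ct_cost_measurable[OF traj that], of J] J
        by auto
    qed
    have "\<exists>T\<ge>max T0 0. V T < \<epsilon>"
    proof (rule ccontr)
      assume "\<not> ?thesis"
      then have ge: "\<epsilon> \<le> V t" if "t \<ge> max T0 0" for t using that by force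
      obtain c where c: "c > 0" "\<And>x. c * (norm x)\<^sup>2 \<le> x \<bullet> Q x" using pos_def_coercive[OF Q] by blast
      obtain C where C: "C > 0" "\<And>x. norm (P x) \<le> C * norm x"
        using linear_bounded_pos[OF pos_def_linear[OF P]] by blast
      define m where "m = c * (\<epsilon> / C)"
      have m: "m > 0" using c C \<epsilon> by (simp add: m_def)
      have cost_ge: "m \<le> cost (x t) (u t)" if "t \<ge> max T0 0" for t
      proof -
        have "\<epsilon> \<le> norm (x t) * norm (P (x t))"
          using ge[OF that] norm_cauchy_schwarz[of "x t" "P (x t)"] by (simp add: V_def)
        also have "\<dots> \<le> norm (x t) * (C * norm (x t))" by (intro mult_left_mono C) auto
        finally have "\<epsilon> / C \<le> (norm (x t))\<^sup>2" using C by (simp add: field_simps power2_eq_square)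
        then have "m \<le> c * (norm (x t))\<^sup>2" unfolding m_def using c by (intro mult_left_mono) auto
        also have "\<dots> \<le> x t \<bullet> Q (x t)" by (rule c(2))
        also have "\<dots> \<le> cost (x t) (u t)" by (rule cost_ge_state)
        finally show ?thesis .
      qed
      define S where "S = max T0 0"
      \<comment> \<open>On an interval of length \<open>(J + 1) / m\<close> a running cost of at
        least \<open>m\<close> accumulates \<open>J + 1\<close>, more than the total cost
        \<open>J\<close>.\<close>
      define T where "T = S + (J + 1) / m"
      have "(J + 1) / m > 0" using m J(2) by (intro divide_pos_pos) auto
      then have T: "S \<le> T" "0 \<le> S" by (auto simp: T_def S_def)
      then obtain I where I: "((\<lambda>t. cost (x t) (u t)) has_integral I) {0..T}" "I \<le> J"
        using fin[of T] by auto
      have "m * (T - S) \<le> I"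
      proof (rule has_integral_le[OF _ I(1)])
        have "((\<lambda>t. m) has_integral m * (T - S)) {S..T}"
          using has_integral_const_real[of m S T] T by (simp add: mult.commute)
        then show "((\<lambda>t. if t \<in> {S..T} then m else 0) has_integral m * (T - S)) {0..T}"
          using T by (subst has_integral_restrict) auto
      qed (use cost_nonneg cost_ge in \<open>auto simp: S_def\<close>)
      then show False using I(2) m by (simp add: T_def)
    qed
    then obtain T where T: "T \<ge> T0" "T \<ge> 0" "V T < \<epsilon>" by auto
    obtain c where c: "((\<lambda>t. cost (x t) (u t)) has_integral c) {0..T}" "c \<le> J"
      using fin[OF T(2)] by blast
    have "(e has_integral (c - (x0 \<bullet> P x0 - V T))) {0..T}"
      using has_integral_diff[OF c(1) ct_trajectory_energy[OF traj pos_def_self_adjoint[OF P] ric T(2)]]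
      by (simp add: e_def[abs_def] V_def)
    moreover from this have "0 \<le> c - (x0 \<bullet> P x0 - V T)" by (rule has_integral_nonneg) (simp add: e)
    ultimately show ?thesis using T c(2) by (intro exI[of _ T] conjI exI[of _ "c - (x0 \<bullet> P x0 - V T)"]) auto
  qed
  show "ennreal (x0 \<bullet> P x0) \<le> ?J"
  proof (cases ?J)
    case (real J)
    have "x0 \<bullet> P x0 \<le> J + \<epsilon>" if "\<epsilon> > 0" for \<epsilon>
      using main[OF real(2,1) that, of 0] by fastforce
    then have "x0 \<bullet> P x0 \<le> J" by (rule field_le_epsilon)
    then show ?thesis using real by (simp add: ennreal_leI)
  qed simp
  assume J: "?J = ennreal (x0 \<bullet> P x0)"
  have "AE t in lborel. t \<in> {0..real n} \<longrightarrow> u t = K (x t)" for n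
  proof -
    \<comment> \<open>With zero excess, \<open>main\<close> bounds the integral of \<open>e\<close>
      up to some \<open>T \<ge> n\<close> by \<open>V T < \<epsilon>\<close>; since \<open>e\<close>
      is nonnegative the shorter interval obeys the same bound.\<close>
    have small: "(\<integral>\<^sup>+t\<in>{0..real n}. ennreal (e t) \<partial>lborel) \<le> ennreal \<epsilon>" if \<epsilon>: "\<epsilon> > 0" for \<epsilon>
    proof -
      obtain T d where Td: "T \<ge> real n" "V T < \<epsilon>" "(e has_integral d) {0..T}" "0 \<le> d" "d \<le> V T"
        using main[OF J pos_def_nonneg[OF P] \<epsilon>, of n] by auto
      have "(\<integral>\<^sup>+t\<in>{0..real n}. ennreal (e t) \<partial>lborel) \<le> (\<integral>\<^sup>+t\<in>{0..T}. ennreal (e t) \<partial>lborel)"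
        using Td(1) by (intro nn_integral_mono) (auto split: split_indicator)
      also have "\<dots> = ennreal d" using nn_integral_has_integral_lebesgue'[OF e Td(3)] by simp
      also have "\<dots> \<le> ennreal \<epsilon>" using Td by (intro ennreal_leI) auto
      finally show ?thesis .
    qed
    have "(\<integral>\<^sup>+t\<in>{0..real n}. ennreal (e t) \<partial>lborel) \<le> 0"
      by (rule ennreal_le_epsilon) (use small in simp)
    then have "(\<integral>\<^sup>+t. ennreal (e t) * indicator {0..real n} t \<partial>lebesgue) = 0"
      by (simp add: nn_integral_completion)
    moreover have "(\<lambda>t. ennreal (e t) * indicator {0..real n} t) \<in> borel_measurable lebesgue"
    proof -
      obtain T d where Td: "T \<ge> real n" "(e has_integral d) {0..T}"
        using main[OF J pos_def_nonneg[OF P] zero_less_one, of n] by auto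
      have [measurable]: "(\<lambda>t. indicator {0..T} t *\<^sub>R e t) \<in> borel_measurable lebesgue"
        by (rule has_integral_implies_lebesgue_measurable[OF Td(2)])
      have [measurable]: "{0..real n} \<in> sets lebesgue" by simp
      have "(\<lambda>t. ennreal (indicator {0..T} t *\<^sub>R e t) * indicator {0..real n} t) \<in> borel_measurable lebesgue"
        by measurable
      moreover have "ennreal (indicator {0..T} t *\<^sub>R e t) * indicator {0..real n} t =
          ennreal (e t) * indicator {0..real n} t" for t
        using Td(1) by (simp split: split_indicator)
      ultimately show ?thesis by simp
    qed
    ultimately have "AE t in lebesgue. ennreal (e t) * indicator {0..real n} t = 0"
      by (simp add: nn_integral_0_iff_AE)
    then have "AE t in lborel. ennreal (e t) * indicator {0..real n} t = 0"
      by (simp add: AE_completion_iff)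
    then show ?thesis
    proof eventually_elim
      case (elim t)
      show ?case
      proof
        assume "t \<in> {0..real n}"
        then have "e t = 0" using elim e[of t] by (simp add: ennreal_eq_0_iff)
        then show "u t = K (x t)" by (simp add: e_def pos_def_eq_0 R)
      qed
    qed
  qed
  then have "AE t in lborel. \<forall>n::nat. t \<in> {0..real n} \<longrightarrow> u t = K (x t)"
    unfolding AE_all_countable by blast
  then show "AE t in lborel. t \<ge> 0 \<longrightarrow> u t = K (x t)"
    by eventually_elim (metis atLeastAtMost_iff real_arch_simple)
qed

lemma ct_riccati_unique:
  assumes "pos_def P" "ct_riccati P K" "pos_def P'" "ct_riccati P' K'"
  shows "P = P'"
proof -
  have le: "x0 \<bullet> P' x0 \<le> x0 \<bullet> P x0"
    if "pos_def P" "ct_riccati P K" "pos_def P'" "ct_riccati P' K'" for P K P' K' x0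
  proof -
    have "linear K" using that(2) by (simp add: ct_riccati_def ct_opt_gain_def)
    then obtain x where x: "ct_trajectory x0 x (\<lambda>t. K (x t))"
      by (rule ct_closed_loop_trajectory)
    have "ennreal (x0 \<bullet> P' x0) \<le> ennreal (x0 \<bullet> P x0)"
      using ct_cost_lower_bound(1)[OF x that(3,4)] ct_closed_loop_cost_le[OF x that(1,2)]
      by (rule order_trans)
    then show ?thesis using pos_def_nonneg[OF that(1)] by (simp add: ennreal_le_iff)
  qed
  show ?thesis
    by (rule self_adjoint_eqI) (use le assms in \<open>auto intro!: pos_def_self_adjoint order_antisym\<close>)
qed

lemma ct_opt_gain_exists:
  assumes P: "linear P"
  shows "\<exists>K. ct_opt_gain P K"
proof -
  obtain g where g: "linear g" "\<And>u. R (g u) = u"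
    using linear_injective_isomorphism[OF pos_def_linear[OF R] inj_pos_def[OF R]] by metis
  define K where "K x = g (- adjoint B (P x))" for x
  have "linear K"
    unfolding K_def using adjoint_linear[OF B]
    by (intro linearI) (simp_all add: linear_add[OF P] linear_add[OF adjoint_linear[OF B]]
        linear_diff[OF g(1)] linear_neg[OF g(1)] linear_add[OF g(1)] linear_scale[OF g(1)]
        linear_scale[OF P] linear_scale[OF adjoint_linear[OF B]])
  then have "ct_opt_gain P K"
    by (simp add: ct_opt_gain_def K_def g(2) adjoint_works[OF B])
  then show ?thesis by blast
qed

end

section \<open>Kleinman's policy iteration\<close>

text \<open>Combines evaluation and improvement. By completing the square, replacing
  \<open>K\<close> with the gain \<open>K'\<close> belonging to \<open>P\<close> leaves the residual
  \<open>- (K x - K' x) \<bullet> R (K x - K' x)\<close>. Hence \<open>P\<close> is a Lyapunov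
  function for the improved loop, which keeps the iteration among stabilizing feedbacks.\<close>

lemma ct_policy_evaluation:
  fixes A :: "complex^'n::finite \<Rightarrow> complex^'n" and B :: "complex^'m::finite \<Rightarrow> complex^'n"
  assumes "lqr A B Q R" and K: "linear K" and stable: "ct_stable (\<lambda>x. A x + B (K x))"
  obtains P where "pos_def P"
    and "\<And>x. 2 * (P x \<bullet> (A x + B (K x))) + lqr.cost Q R x (K x) = 0"
    and "\<And>K' x. lqr.ct_opt_gain B R P K' \<Longrightarrow> 2 * (P x \<bullet> (A x + B (K' x))) + lqr.cost Q R x (K' x) \<le> 0"
proof -
  interpret lqr A B Q R by fact
  have W: "psd (\<lambda>x. Q x + adjoint K (R (K x)))"
    by (intro psd_add psd_congruence(1)[OF pos_def_psd[OF R] K] pos_def_psd Q)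
  obtain P where P: "psd P"
    "\<And>x. 2 * (P x \<bullet> (A x + B (K x))) + x \<bullet> (Q x + adjoint K (R (K x))) = 0"
    using lyapunov_equation[OF linear_closed_loop[OF K] stable W] by blast
  have eq: "2 * (P x \<bullet> (A x + B (K x))) + cost x (K x) = 0" for x
    using P(2)[of x] by (simp add: cost_def inner_add_right psd_congruence(2)[OF pos_def_psd[OF R] K])
  have "pos_def P"
    unfolding pos_def_def
  proof (intro conjI allI impI)
    fix x :: "complex^'n" assume "x \<noteq> 0"
    \<comment> \<open>At a zero of \<open>P\<close> the Lyapunov equation would make the running
      cost vanish. Since a semidefinite form vanishes only on the kernel of its operator, strict
      positivity follows.\<close>
    have "P x \<noteq> 0"
    proof
      assume "P x = 0"
      then have "cost x (K x) = 0" using eq[of x] by simp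
      then have "x \<bullet> Q x \<le> 0" using cost_ge_state[of x "K x"] by simp
      then show False using pos_def_pos[OF Q \<open>x \<noteq> 0\<close>] by simp
    qed
    then show "0 < x \<bullet> P x" using psd_eq_0[OF P(1)] psd_nonneg[OF P(1)] by (metis less_eq_real_def)
  qed (rule psd_self_adjoint[OF P(1)])
  then show ?thesis
  proof (rule that)
    show "2 * (P x \<bullet> (A x + B (K' x))) + cost x (K' x) \<le> 0" if "ct_opt_gain P K'" for K' x
      using ct_complete_square[OF that, of x "K x"] eq[of x] pos_def_nonneg[OF R, of "K x - K' x"]
      by linarith
  qed (rule eq)
qed

lemma ct_riccati_exists_of_stabilizing:
  fixes A :: "complex^'n::finite \<Rightarrow> complex^'n" and B :: "complex^'m::finite \<Rightarrow> complex^'n"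
  assumes lqr: "lqr A B Q R" and K0: "linear K0" and stable: "ct_stable (\<lambda>x. A x + B (K0 x))"
  obtains P K where "pos_def P" "lqr.ct_riccati A B Q R P K"
proof -
  interpret lqr A B Q R by fact
  \<comment> \<open>The invariant pairs a supersolution with its own optimal gain; the inequality is
    what guarantees stability of the next closed loop.\<close>
  define good where "good P K \<longleftrightarrow> pos_def P \<and> ct_opt_gain P K \<and>
      (\<forall>x. 2 * (P x \<bullet> (A x + B (K x))) + cost x (K x) \<le> 0)" for P K
  have "\<exists>f. \<forall>k::nat. good (fst (f k)) (snd (f k)) \<and>
      ((\<forall>x. x \<bullet> fst (f (Suc k)) x \<le> x \<bullet> fst (f k) x) \<and>
       (\<forall>x. 2 * (fst (f (Suc k)) x \<bullet> (A x + B (snd (f k) x))) + cost x (snd (f k) x) = 0))"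
  proof (rule dependent_nat_choice[where P = "\<lambda>_ p. good (fst p) (snd p)" and
        Q = "\<lambda>_ p q. (\<forall>x. x \<bullet> fst q x \<le> x \<bullet> fst p x) \<and>
          (\<forall>x. 2 * (fst q x \<bullet> (A x + B (snd p x))) + cost x (snd p x) = 0)"])
    obtain P where P: "pos_def P"
      "\<And>K x. ct_opt_gain P K \<Longrightarrow> 2 * (P x \<bullet> (A x + B (K x))) + cost x (K x) \<le> 0"
      by (rule ct_policy_evaluation[OF lqr K0 stable]) (rule that)
    obtain K where "ct_opt_gain P K" using ct_opt_gain_exists[OF pos_def_linear[OF P(1)]] by blast
    then show "\<exists>p. good (fst p) (snd p)" using P by (intro exI[of _ "(P, K)"]) (simp add: good_def)
  next
    fix p :: "(complex^'n \<Rightarrow> complex^'n) \<times> (complex^'n \<Rightarrow> complex^'m)" and k :: nat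
    obtain P K where p: "p = (P, K)" by (cases p)
    assume "good (fst p) (snd p)"
    then have P: "pos_def P" "ct_opt_gain P K"
      "\<And>x. 2 * (P x \<bullet> (A x + B (K x))) + cost x (K x) \<le> 0" by (auto simp: good_def p)
    have K: "linear K" using P(2) by (simp add: ct_opt_gain_def)
    have st: "ct_stable (\<lambda>x. A x + B (K x))" by (rule ct_closed_loop_stable[OF P(1) K P(3)])
    obtain P' where P': "pos_def P'" "\<And>x. 2 * (P' x \<bullet> (A x + B (K x))) + cost x (K x) = 0"
      "\<And>K' x. ct_opt_gain P' K' \<Longrightarrow> 2 * (P' x \<bullet> (A x + B (K' x))) + cost x (K' x) \<le> 0"
      by (rule ct_policy_evaluation[OF lqr K st]) (rule that)
    obtain K' where K': "ct_opt_gain P' K'" using ct_opt_gain_exists[OF pos_def_linear[OF P'(1)]] by blast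
    \<comment> \<open>Along the common closed loop \<open>P\<close> satisfies an inequality and
      \<open>P'\<close> the equation, so the form of \<open>P - P'\<close> cannot increase there,
      and stability makes it nonnegative.\<close>
    have sa: "self_adjoint (\<lambda>x. P x - P' x)"
      using pos_def_self_adjoint[OF P(1)] pos_def_self_adjoint[OF P'(1)]
      by (auto simp: self_adjoint_def inner_diff_left inner_diff_right intro: linear_compose_sub)
    have "x \<bullet> P' x \<le> x \<bullet> P x" for x
    proof -
      have "0 \<le> x \<bullet> (P x - P' x)"
      proof (rule ct_stable_quadratic_nonneg[OF linear_closed_loop[OF K] st sa])
        show "(P y - P' y) \<bullet> (A y + B (K y)) \<le> 0" for y
          using P(3)[of y] P'(2)[of y] by (simp add: inner_diff_left)
      qed
      then show ?thesis by (simp add: inner_diff_right)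
    qed
    then show "\<exists>q. good (fst q) (snd q) \<and> (\<forall>x. x \<bullet> fst q x \<le> x \<bullet> fst p x) \<and>
        (\<forall>x. 2 * (fst q x \<bullet> (A x + B (snd p x))) + cost x (snd p x) = 0)"
      using P' K' by (intro exI[of _ "(P', K')"]) (simp add: good_def p)
  qed
  then obtain f where f: "\<And>k. good (fst (f k)) (snd (f k))"
    "\<And>k x. x \<bullet> fst (f (Suc k)) x \<le> x \<bullet> fst (f k) x"
    "\<And>k x. 2 * (fst (f (Suc k)) x \<bullet> (A x + B (snd (f k) x))) + cost x (snd (f k) x) = 0"
    by blast
  define P V where "P k = fst (f k)" and "V k = snd (f k)" for k
  have psd: "psd (P k)" and V: "ct_opt_gain (P k) (V k)" for k
    using f(1)[of k] pos_def_psd by (auto simp: good_def P_def V_def)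
  have dec: "x \<bullet> P (Suc k) x \<le> x \<bullet> P k x" for k x unfolding P_def by (rule f(2))
  have step: "2 * (P (Suc k) x \<bullet> (A x + B (V k x))) + cost x (V k x) = 0" for k x
    unfolding P_def V_def by (rule f(3))
  obtain L where L: "psd L" "\<And>x. (\<lambda>k. P k x) \<longlonglongrightarrow> L x"
    using decreasing_psd_limit[of P, OF psd dec] by blast
  obtain K where K: "ct_opt_gain L K" using ct_opt_gain_exists[OF psd_linear[OF L(1)]] by blast
  have Vlim: "(\<lambda>k. V k x) \<longlonglongrightarrow> K x" for x
  proof (rule coercive_tendsto[OF L(2)])
    fix k
    have "u \<bullet> R (V k x) = - (B u \<bullet> P k x)" "u \<bullet> R (K x) = - (B u \<bullet> L x)" for u
      using V[of k] K by (simp_all add: ct_opt_gain_def)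
    then show "(V k x - K x) \<bullet> R (V k x - K x) \<le> - (B (V k x - K x) \<bullet> (P k x - L x))"
      by (simp add: linear_diff[OF pos_def_linear[OF R]] inner_diff_right)
  qed
  \<comment> \<open>The evaluation step relates \<open>P (Suc k)\<close> to \<open>V k\<close>; both
    indices drop out in the limit because operators and gains converge separately.\<close>
  have ric: "2 * (L x \<bullet> (A x + B (K x))) + cost x (K x) = 0" for x
  proof (rule LIMSEQ_unique)
    show "(\<lambda>k. 2 * (P (Suc k) x \<bullet> (A x + B (V k x))) + cost x (V k x)) \<longlonglongrightarrow>
        2 * (L x \<bullet> (A x + B (K x))) + cost x (K x)"
      unfolding cost_def
      by (intro tendsto_intros LIMSEQ_Suc L Vlim
          bounded_linear.tendsto[OF linear_conv_bounded_linear[THEN iffD1, OF B]]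
          bounded_linear.tendsto[OF linear_conv_bounded_linear[THEN iffD1, OF pos_def_linear[OF R]]])
    show "(\<lambda>k. 2 * (P (Suc k) x \<bullet> (A x + B (V k x))) + cost x (V k x)) \<longlonglongrightarrow> 0"
      by (simp add: step)
  qed
  have "pos_def L"
    unfolding pos_def_def
  proof (intro conjI allI impI)
    fix x :: "complex^'n" assume "x \<noteq> 0"
    have "L x \<noteq> 0"
      using ric[of x] cost_ge_state[of x "K x"] pos_def_pos[OF Q \<open>x \<noteq> 0\<close>] by auto
    then show "0 < x \<bullet> L x" using psd_eq_0[OF L(1)] psd_nonneg[OF L(1)] by (metis less_eq_real_def)
  qed (rule psd_self_adjoint[OF L(1)])
  then show ?thesis using that ric K unfolding ct_riccati_def by blast
qed

section \<open>Riccati equations for bimatrices\<close>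

context lqr
begin

lemma ct_opt_gain_unique:
  assumes "ct_opt_gain P K" "ct_opt_gain P K'"
  shows "K = K'"
proof
  fix x
  let ?d = "K x - K' x"
  have "?d \<bullet> R (K x) = ?d \<bullet> R (K' x)" using assms by (simp add: ct_opt_gain_def)
  then have "?d \<bullet> R ?d = 0" by (simp add: linear_diff[OF pos_def_linear[OF R]] inner_diff_right)
  then show "K x = K' x" by (simp add: pos_def_eq_0[OF R])
qed

lemma dt_opt_gain_unique:
  assumes "dt_opt_gain P K" "dt_opt_gain P K'" and P: "psd P"
  shows "K = K'"
proof
  fix x
  let ?d = "K x - K' x"
  have "?d \<bullet> R (K x) + B ?d \<bullet> P (B (K x)) = ?d \<bullet> R (K' x) + B ?d \<bullet> P (B (K' x))"
    using assms by (simp add: dt_opt_gain_def)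
  moreover have "B ?d \<bullet> P (B ?d) = B ?d \<bullet> P (B (K x)) - B ?d \<bullet> P (B (K' x))"
    by (simp add: linear_diff[OF B] linear_diff[OF psd_linear[OF P]] inner_diff_right)
  moreover have "?d \<bullet> R ?d = ?d \<bullet> R (K x) - ?d \<bullet> R (K' x)"
    by (simp add: linear_diff[OF pos_def_linear[OF R]] inner_diff_right)
  ultimately have "?d \<bullet> R ?d \<le> 0" using psd_nonneg[OF P, of "B ?d"] by linarith
  then show "K x = K' x" using pos_def_pos[OF R, of ?d] by force
qed

text \<open>The residual \<open>M\<close> of the operator equation is self-adjoint, so it vanishes
  as soon as its quadratic form does. Symmetry of the term \<open>P (B (K x))\<close> is seen by
  rewriting its pairing with \<open>y\<close> as \<open>- (K x \<bullet> R (K y))\<close>.\<close>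

lemma ct_riccati_iff:
  assumes K: "ct_opt_gain P K" and P: "self_adjoint P"
  shows "ct_riccati P K \<longleftrightarrow> (\<forall>x. - Q x = adjoint A (P x) + P (A x) + P (B (K x)))"
proof -
  note lin = self_adjoint_linear[OF P]
  define M where "M x = Q x + adjoint A (P x) + P (A x) + P (B (K x))" for x
  have linK: "linear K" using K by (simp add: ct_opt_gain_def)
  have inner: "y \<bullet> M x = y \<bullet> Q x + A y \<bullet> P x + y \<bullet> P (A x) - K x \<bullet> R (K y)" for x y
  proof -
    have "y \<bullet> P (B (K x)) = B (K x) \<bullet> P y" by (rule self_adjoint_commute[OF P])
    also have "\<dots> = - (K x \<bullet> R (K y))" using K by (simp add: ct_opt_gain_def)
    finally show ?thesis by (simp add: M_def inner_add_right adjoint_works[OF A])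
  qed
  have "linear (\<lambda>x. adjoint A (P x))" "linear (\<lambda>x. P (A x))" "linear (\<lambda>x. P (B (K x)))"
    using linear_compose[OF lin adjoint_linear[OF A]] linear_compose[OF A lin]
      linear_compose[OF linear_compose[OF linK B] lin] by (simp_all add: o_def)
  then have "linear M"
    unfolding M_def[abs_def] by (intro linear_compose_add pos_def_linear[OF Q])
  moreover have "M x \<bullet> y = x \<bullet> M y" for x y
    unfolding inner_commute[of "M x"] inner
    using self_adjoint_commute[OF pos_def_self_adjoint[OF Q], of y x] self_adjoint_commute[OF P, of y "A x"]
      self_adjoint_commute[OF P, of x "A y"]
      self_adjoint_commute[OF pos_def_self_adjoint[OF R], of "K x" "K y"] by linarith
  ultimately have M: "self_adjoint M" by (simp add: self_adjoint_def)
  have "2 * (P x \<bullet> (A x + B (K x))) + cost x (K x) = x \<bullet> M x" for x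
  proof -
    have "P x \<bullet> B (K x) = - (K x \<bullet> R (K x))"
      using K by (simp add: ct_opt_gain_def inner_commute)
    then show ?thesis
      using self_adjoint_commute[OF P, of x "A x"]
      by (simp add: inner cost_def inner_add_right inner_commute)
  qed
  then have "ct_riccati P K \<longleftrightarrow> (\<forall>x. x \<bullet> M x = 0)" using K by (simp add: ct_riccati_def)
  also have "\<dots> \<longleftrightarrow> (\<forall>x. M x = 0)" using self_adjoint_eq_0[OF M] by auto
  also have "\<dots> \<longleftrightarrow> (\<forall>x. - Q x = adjoint A (P x) + P (A x) + P (B (K x)))"
    by (simp add: M_def add.assoc neg_eq_iff_add_eq_0)
  finally show ?thesis .
qed

text \<open>Here the gain condition turns the pairing of the last term with \<open>y\<close> into
  the symmetric expression \<open>- (K x \<bullet> R (K y) + B (K x) \<bullet> P (B (K y)))\<close>,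
  so the residual is again determined by its quadratic form.\<close>

lemma dt_riccati_iff:
  assumes K: "dt_opt_gain P K" and P: "self_adjoint P"
  shows "dt_riccati P K \<longleftrightarrow> (\<forall>x. - Q x = adjoint A (P (A x)) - P x + adjoint A (P (B (K x))))"
proof -
  note lin = self_adjoint_linear[OF P]
  define M where "M x = Q x + (adjoint A (P (A x)) - P x + adjoint A (P (B (K x))))" for x
  have linK: "linear K" using K by (simp add: dt_opt_gain_def)
  have inner: "y \<bullet> M x = y \<bullet> Q x + A y \<bullet> P (A x) - y \<bullet> P x - (K x \<bullet> R (K y) + B (K x) \<bullet> P (B (K y)))" for x y
  proof -
    have "A y \<bullet> P (B (K x)) = B (K x) \<bullet> P (A y)" by (rule self_adjoint_commute[OF P])
    also have "\<dots> = - (K x \<bullet> R (K y) + B (K x) \<bullet> P (B (K y)))" using K by (simp add: dt_opt_gain_def)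
    finally show ?thesis by (simp add: M_def inner_add_right inner_diff_right adjoint_works[OF A])
  qed
  have "linear (\<lambda>x. adjoint A (P (A x)))" "linear (\<lambda>x. adjoint A (P (B (K x))))"
    using linear_compose[OF linear_compose[OF A lin] adjoint_linear[OF A]]
      linear_compose[OF linear_compose[OF linear_compose[OF linK B] lin] adjoint_linear[OF A]]
    by (simp_all add: o_def)
  then have "linear M"
    unfolding M_def[abs_def] by (intro linear_compose_add linear_compose_sub pos_def_linear[OF Q] lin)
  moreover have "M x \<bullet> y = x \<bullet> M y" for x y
    unfolding inner_commute[of "M x"] inner
    using self_adjoint_commute[OF pos_def_self_adjoint[OF Q], of y x] self_adjoint_commute[OF P, of y x]
      self_adjoint_commute[OF P, of "A x" "A y"] self_adjoint_commute[OF P, of "B (K x)" "B (K y)"]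
      self_adjoint_commute[OF pos_def_self_adjoint[OF R], of "K x" "K y"] by linarith
  ultimately have M: "self_adjoint M" by (simp add: self_adjoint_def)
  have "x \<bullet> P x = cost x (K x) + (A x + B (K x)) \<bullet> P (A x + B (K x)) \<longleftrightarrow> x \<bullet> M x = 0" for x
  proof -
    have "K x \<bullet> R (K x) + B (K x) \<bullet> P (B (K x)) = - (B (K x) \<bullet> P (A x))"
      using K by (simp add: dt_opt_gain_def)
    then show ?thesis
      unfolding inner cost_def self_adjoint_quadratic_add[OF P] by linarith
  qed
  then have "dt_riccati P K \<longleftrightarrow> (\<forall>x. x \<bullet> M x = 0)"
    unfolding dt_riccati_def using K by blast
  also have "\<dots> \<longleftrightarrow> (\<forall>x. M x = 0)" using self_adjoint_eq_0[OF M] by auto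
  also have "\<dots> \<longleftrightarrow> (\<forall>x. - Q x = adjoint A (P (A x)) - P x + adjoint A (P (B (K x))))"
    by (simp only: M_def neg_eq_iff_add_eq_0)
  finally show ?thesis .
qed

end

section \<open>Transfer of the operator results to bimatrices\<close>

lemma adjoint_bm_app: "adjoint (bm_app X) = bm_app (bm_H X)"
  by (rule adjoint_unique) (simp add: inner_bm_app_H)

lemma stage_cost_eq: "stage_cost Q R x u = lqr.cost (bm_app Q) (bm_app R) x u"
  if "lqr A B (bm_app Q) (bm_app R)"
  using that by (simp add: stage_cost_def lqr.cost_def Re_cinner)

context
  fixes A :: "('n::finite,'n) bimat" and B :: "('n,'m::finite) bimat"
    and Q :: "('n,'n) bimat" and R :: "('m,'m) bimat"
  assumes Q: "bm_pos_def Q" and R: "bm_pos_def R"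
begin

interpretation lqr "bm_app A" "bm_app B" "bm_app Q" "bm_app R"
  using Q R by (intro lqr.intro linear_bm_app) (simp_all add: bm_pos_def_iff)

lemma ct_gain_opt: "ct_opt_gain (bm_app P) (bm_app (ct_gain B R P))"
  using inj_pos_def[OF R[unfolded bm_pos_def_iff]]
  by (simp add: ct_opt_gain_def linear_bm_app ct_gain_def linear_neg[OF linear_bm_app] bm_app_inv
      inner_bm_app_H)

lemma care_iff:
  assumes "bm_pos_def P"
  shows "care A B Q R P \<longleftrightarrow> ct_riccati (bm_app P) (bm_app (ct_gain B R P))"
  unfolding ct_riccati_iff[OF ct_gain_opt pos_def_self_adjoint[OF assms[unfolded bm_pos_def_iff]]]
  by (simp add: care_def bm_eq_def fun_eq_iff adjoint_bm_app ct_gain_def linear_neg[OF linear_bm_app])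

text \<open>\<open>dS B R P\<close> is injective because its form is at least that of
  \<open>R\<close>; only then does \<open>bm_inv\<close> denote a true inverse.\<close>

lemma dt_gain_opt:
  assumes "bm_pos_def P"
  shows "dt_opt_gain (bm_app P) (bm_app (dt_gain A B R P))"
proof -
  have P: "psd (bm_app P)" using assms by (simp add: bm_pos_def_iff pos_def_psd)
  have S: "u \<bullet> bm_app (dS B R P) v = u \<bullet> bm_app R v + bm_app B u \<bullet> bm_app P (bm_app B v)" for u v
    by (simp add: dS_def inner_add_right inner_bm_app_H)
  have "inj (bm_app (dS B R P))"
  proof (subst linear_injective_0[OF linear_bm_app], intro allI impI)
    fix u assume "bm_app (dS B R P) u = 0"
    then have "u \<bullet> bm_app R u \<le> 0" using S[of u u] psd_nonneg[OF P, of "bm_app B u"] by simp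
    then show "u = 0" using R pos_def_pos[of "bm_app R" u] by (force simp: bm_pos_def_iff)
  qed
  then have "bm_app (dS B R P) (bm_app (dt_gain A B R P) x) = - bm_app (bm_H B) (bm_app P (bm_app A x))" for x
    by (simp add: dt_gain_def linear_neg[OF linear_bm_app] bm_app_inv)
  then have "u \<bullet> bm_app (dS B R P) (bm_app (dt_gain A B R P) x) = - (bm_app B u \<bullet> bm_app P (bm_app A x))" for x u
    by (simp add: inner_bm_app_H)
  then show ?thesis by (simp add: dt_opt_gain_def linear_bm_app S)
qed

lemma dare_iff:
  assumes "bm_pos_def P"
  shows "dare A B Q R P \<longleftrightarrow> dt_riccati (bm_app P) (bm_app (dt_gain A B R P))"
  unfolding dt_riccati_iff[OF dt_gain_opt[OF assms] pos_def_self_adjoint[OF assms[unfolded bm_pos_def_iff]]]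
  by (simp add: dare_def bm_eq_def fun_eq_iff adjoint_bm_app dt_gain_def linear_neg[OF linear_bm_app])

lemma ct_asymp_stable_iff:
  "ct_asymp_stable (bm_add A (bm_mult B K)) \<longleftrightarrow> ct_stable (\<lambda>x. bm_app A x + bm_app B (bm_app K x))"
  by (simp add: ct_asymp_stable_def ct_stable_def primitive_def)

lemma ct_traj_iff: "ct_traj A B x0 x u \<longleftrightarrow> ct_trajectory x0 x u"
  by (simp add: ct_traj_def ct_trajectory_def primitive_def)

lemma ct_cost_eq: "ct_cost Q R x u = (\<integral>\<^sup>+t\<in>{0..}. ennreal (cost (x t) (u t)) \<partial>lborel)"
  by (simp add: ct_cost_def stage_cost_eq[OF lqr_axioms])

lemma dt_cost_eq: "dt_cost Q R x u = (\<Sum>t. ennreal (cost (x t) (u t)))"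
  by (simp add: dt_cost_def stage_cost_eq[OF lqr_axioms])

lemma ct_care_unique_solution:
  assumes "ct_stabilizable A B"
  shows "\<exists>!P. bm_pos_def P \<and> care A B Q R P"
proof -
  obtain K0 where "ct_stable (\<lambda>x. bm_app A x + bm_app B (bm_app K0 x))"
    using assms by (auto simp: ct_stabilizable_def ct_asymp_stable_iff)
  then obtain P' K where P': "pos_def P'" "ct_riccati P' K"
    by (rule ct_riccati_exists_of_stabilizing[OF lqr_axioms linear_bm_app])
  obtain P where P: "bm_app P = P'" by (rule ex_bm_app[OF pos_def_linear[OF P'(1)]])
  have pos: "bm_pos_def P" using P'(1) P by (simp add: bm_pos_def_iff)
  \<comment> \<open>The iteration delivers some gain satisfying the weak condition; positive
    definiteness of \<open>R\<close> identifies it with the explicit formula of the theorem.\<close>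
  have "K = bm_app (ct_gain B R P)"
    using ct_opt_gain_unique[OF _ ct_gain_opt] P'(2) P by (auto simp: ct_riccati_def)
  then have "care A B Q R P" using P'(2) P by (simp add: care_iff[OF pos])
  moreover have "P1 = P2" if "bm_pos_def P1" "care A B Q R P1" "bm_pos_def P2" "care A B Q R P2" for P1 P2
    using ct_riccati_unique that care_iff by (metis bm_app_inject bm_pos_def_iff)
  ultimately show ?thesis using pos by blast
qed

lemma dt_dare_unique_solution:
  assumes "dt_stabilizable A B"
  shows "\<exists>!P. bm_pos_def P \<and> dare A B Q R P"
proof -
  obtain K0 where K0: "dt_asymp_stable (bm_add A (bm_mult B K0))"
    using assms by (auto simp: dt_stabilizable_def)
  have "(\<lambda>t. ((\<lambda>x. bm_app A x + bm_app B (bm_app K0 x)) ^^ t) x) \<longlonglongrightarrow> 0" for x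
    using K0 by (simp add: dt_asymp_stable_def)
  then obtain P' K where P': "pos_def P'" "dt_riccati P' K"
    by (rule dt_riccati_exists_of_stabilizing[OF lqr_axioms linear_bm_app])
  obtain P where P: "bm_app P = P'" by (rule ex_bm_app[OF pos_def_linear[OF P'(1)]])
  have pos: "bm_pos_def P" using P'(1) P by (simp add: bm_pos_def_iff)
  have "dt_opt_gain P' K" using P'(2) unfolding dt_riccati_def by blast
  then have "K = bm_app (dt_gain A B R P)"
    using dt_opt_gain_unique[OF _ dt_gain_opt[OF pos]] pos_def_psd[OF P'(1)] P by simp
  then have "dare A B Q R P" using P'(2) P by (simp add: dare_iff[OF pos])
  moreover have "P1 = P2" if "bm_pos_def P1" "dare A B Q R P1" "bm_pos_def P2" "dare A B Q R P2" for P1 P2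
    using dt_riccati_unique that dare_iff by (metis bm_app_inject bm_pos_def_iff)
  ultimately show ?thesis using pos by blast
qed

text \<open>Existence of a closed-loop trajectory is included so that the statement on its cost is
  not vacuous; in discrete time recursion provides one at once.\<close>

lemma ct_optimal_feedback:
  assumes P: "bm_pos_def P" "care A B Q R P"
  defines "K \<equiv> ct_gain B R P"
  shows "ct_asymp_stable (bm_add A (bm_mult B K))"
    and "\<exists>x. ct_traj A B x0 x (\<lambda>t. bm_app K (x t))"
    and "ct_traj A B x0 x (\<lambda>t. bm_app K (x t)) \<Longrightarrow>
      ct_cost Q R x (\<lambda>t. bm_app K (x t)) = ennreal (Re (cinner x0 (bm_app P x0)))"
    and "ct_traj A B x0 x u \<Longrightarrow> ennreal (Re (cinner x0 (bm_app P x0))) \<le> ct_cost Q R x u"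
    and "ct_traj A B x0 x u \<Longrightarrow> ct_cost Q R x u = ennreal (Re (cinner x0 (bm_app P x0))) \<Longrightarrow>
      AE t in lborel. t \<ge> 0 \<longrightarrow> u t = bm_app K (x t)"
proof -
  have pos: "pos_def (bm_app P)" using P(1) by (simp add: bm_pos_def_iff)
  have ric: "ct_riccati (bm_app P) (bm_app K)" using P care_iff by (simp add: K_def)
  show "ct_asymp_stable (bm_add A (bm_mult B K))"
    unfolding ct_asymp_stable_iff
    by (rule ct_closed_loop_stable[OF pos linear_bm_app]) (use ric in \<open>simp add: ct_riccati_def\<close>)
  show "\<exists>x. ct_traj A B x0 x (\<lambda>t. bm_app K (x t))"
    using ct_closed_loop_trajectory[OF linear_bm_app, of x0 K] by (auto simp: ct_traj_iff)
  show lower: "ennreal (Re (cinner x0 (bm_app P x0))) \<le> ct_cost Q R x u"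
    if "ct_traj A B x0 x u" for x u
    using ct_cost_lower_bound(1)[OF _ pos ric] that by (simp add: ct_traj_iff ct_cost_eq Re_cinner)
  show "ct_cost Q R x (\<lambda>t. bm_app K (x t)) = ennreal (Re (cinner x0 (bm_app P x0)))"
    if "ct_traj A B x0 x (\<lambda>t. bm_app K (x t))"
  proof (rule antisym)
    show "ct_cost Q R x (\<lambda>t. bm_app K (x t)) \<le> ennreal (Re (cinner x0 (bm_app P x0)))"
      using ct_closed_loop_cost_le[OF _ pos ric] that by (simp add: ct_traj_iff ct_cost_eq Re_cinner)
  qed (rule lower[OF that])
  show "AE t in lborel. t \<ge> 0 \<longrightarrow> u t = bm_app K (x t)"
    if "ct_traj A B x0 x u" "ct_cost Q R x u = ennreal (Re (cinner x0 (bm_app P x0)))"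
    using ct_cost_lower_bound(2)[OF _ pos ric] that by (simp add: ct_traj_iff ct_cost_eq Re_cinner)
qed

lemma dt_optimal_feedback:
  assumes P: "bm_pos_def P" "dare A B Q R P"
  defines "K \<equiv> dt_gain A B R P"
  shows "dt_asymp_stable (bm_add A (bm_mult B K))"
    and "dt_traj A B x0 x (\<lambda>t. bm_app K (x t)) \<Longrightarrow>
      dt_cost Q R x (\<lambda>t. bm_app K (x t)) = ennreal (Re (cinner x0 (bm_app P x0)))"
    and "dt_traj A B x0 x u \<Longrightarrow> ennreal (Re (cinner x0 (bm_app P x0))) \<le> dt_cost Q R x u"
    and "dt_traj A B x0 x u \<Longrightarrow> dt_cost Q R x u = ennreal (Re (cinner x0 (bm_app P x0))) \<Longrightarrow>
      u t = bm_app K (x t)"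
proof -
  have pos: "pos_def (bm_app P)" using P(1) by (simp add: bm_pos_def_iff)
  have ric: "dt_riccati (bm_app P) (bm_app K)" using P dare_iff by (simp add: K_def)
  show "dt_asymp_stable (bm_add A (bm_mult B K))"
    unfolding dt_asymp_stable_def by (auto intro!: dt_closed_loop_stable[OF pos ric])
  show "dt_cost Q R x (\<lambda>t. bm_app K (x t)) = ennreal (Re (cinner x0 (bm_app P x0)))"
    if "dt_traj A B x0 x (\<lambda>t. bm_app K (x t))"
    using dt_closed_loop_cost[OF pos ric, of x] that by (auto simp: dt_traj_def dt_cost_eq Re_cinner)
  show "ennreal (Re (cinner x0 (bm_app P x0))) \<le> dt_cost Q R x u" if "dt_traj A B x0 x u"
    using dt_cost_lower_bound(1)[OF pos ric, of x u] that by (auto simp: dt_traj_def dt_cost_eq Re_cinner)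
  show "u t = bm_app K (x t)"
    if "dt_traj A B x0 x u" "dt_cost Q R x u = ennreal (Re (cinner x0 (bm_app P x0)))"
    by (rule dt_cost_lower_bound(2)[OF pos ric, of x u])
      (use that in \<open>auto simp: dt_traj_def dt_cost_eq Re_cinner\<close>)
qed

end

text \<open>In continuous time the minimizer can be unique only almost everywhere: changing
  \<open>u\<close> on a null set affects neither the trajectory nor the cost.\<close>

theorem theorem4:
  fixes A1 A2 :: "complex^'n::finite^'n" and B1 B2 :: "complex^'m::finite^'n"
    and Q1 Q2 :: "complex^'n^'n" and R1 R2 :: "complex^'m^'m"
  assumes Qpos: "bm_pos_def (Q1, Q2)" and Rpos: "bm_pos_def (R1, R2)"
  shows
  "(ct_stabilizable (A1, A2) (B1, B2) \<longrightarrow>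
     (\<exists>!P. bm_pos_def P \<and> care (A1, A2) (B1, B2) (Q1, Q2) (R1, R2) P) \<and>
     (\<forall>P. bm_pos_def P \<and> care (A1, A2) (B1, B2) (Q1, Q2) (R1, R2) P \<longrightarrow>
        (let K = ct_gain (B1, B2) (R1, R2) P in
          ct_asymp_stable (bm_add (A1, A2) (bm_mult (B1, B2) K)) \<and>
          (\<forall>x0. (\<exists>x. ct_traj (A1, A2) (B1, B2) x0 x (\<lambda>t. bm_app K (x t))) \<and>
             (\<forall>x. ct_traj (A1, A2) (B1, B2) x0 x (\<lambda>t. bm_app K (x t)) \<longrightarrow>
                ct_cost (Q1, Q2) (R1, R2) x (\<lambda>t. bm_app K (x t)) = ennreal (Re (cinner x0 (bm_app P x0)))) \<and>
             (\<forall>x u. ct_traj (A1, A2) (B1, B2) x0 x u \<longrightarrow>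
                ennreal (Re (cinner x0 (bm_app P x0))) \<le> ct_cost (Q1, Q2) (R1, R2) x u \<and>
                (ct_cost (Q1, Q2) (R1, R2) x u = ennreal (Re (cinner x0 (bm_app P x0))) \<longrightarrow>
                   (AE t in lborel. t \<ge> 0 \<longrightarrow> u t = bm_app K (x t))))))))
   \<and>
   (dt_stabilizable (A1, A2) (B1, B2) \<longrightarrow>
     (\<exists>!P. bm_pos_def P \<and> dare (A1, A2) (B1, B2) (Q1, Q2) (R1, R2) P) \<and>
     (\<forall>P. bm_pos_def P \<and> dare (A1, A2) (B1, B2) (Q1, Q2) (R1, R2) P \<longrightarrow>
        (let K = dt_gain (A1, A2) (B1, B2) (R1, R2) P in
          dt_asymp_stable (bm_add (A1, A2) (bm_mult (B1, B2) K)) \<and>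
          (\<forall>x0. (\<forall>x. dt_traj (A1, A2) (B1, B2) x0 x (\<lambda>t. bm_app K (x t)) \<longrightarrow>
                dt_cost (Q1, Q2) (R1, R2) x (\<lambda>t. bm_app K (x t)) = ennreal (Re (cinner x0 (bm_app P x0)))) \<and>
             (\<forall>x u. dt_traj (A1, A2) (B1, B2) x0 x u \<longrightarrow>
                ennreal (Re (cinner x0 (bm_app P x0))) \<le> dt_cost (Q1, Q2) (R1, R2) x u \<and>
                (dt_cost (Q1, Q2) (R1, R2) x u = ennreal (Re (cinner x0 (bm_app P x0))) \<longrightarrow>
                   (\<forall>t. u t = bm_app K (x t))))))))"
  unfolding Let_def
  by (intro conjI impI allI; (elim conjE)?;
      (rule ct_care_unique_solution[OF Qpos Rpos] dt_dare_unique_solution[OF Qpos Rpos]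
          ct_optimal_feedback[OF Qpos Rpos] dt_optimal_feedback[OF Qpos Rpos]; assumption))

end
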